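(* If $\tilde b\in L^\infty{\rm BMO}^{-1}$, then $\tilde b\in\mathbf M_\delta$ (for some $\delta<\infty$).
   Context: The space dimension is $d\ge3$; $\mathbb R_+=[0,\infty[$; $\mathcal S$, $\mathcal S'$ are the Schwartz space and tempered distributions on $\mathbb R^d$; $\langle f,g\rangle=\int_{\mathbb R^d}f\bar g\,dx$; $\|\cdot\|_2$ is the $L^2(\mathbb R^d)$ norm. $L^\infty{\rm BMO}^{-1}$: vector fields $b:\mathbb R_+\to[\mathcal S']^d$ with ${\rm div}\,b=0$ such that $b_k(t)=\sum_{i=1}^d\nabla_iB_{ik}(t)$, $t\in\mathbb R_+$, for some skew-symmetric matrix $B$ with entries $B_{ik}\in L^\infty(\mathbb R_+,{\rm BMO}(\mathbb R^d))$. The functions $B_{ik}$ are assumed to be chosen (by adding functions depending only on $t$) in $L^q_{\rm loc}(\mathbb R_+\times\mathbb R^d)$ for all $1\le q<\infty$. $\mathbf M_\delta$: distributional vector fields $b:\mathbb R_+\to[\mathcal S']^d$ such that for a.e. $t\in\mathbb R_+$, $|\langle b(t)\psi,\psi\rangle|\le\delta\|\nabla\psi\|_2\|\psi\|_2+g(t)\|\psi\|_2^2$ for all $\psi\in\mathcal S$, for a non-negative function $g$ that satisfies, on every finite interval $[0,T]$, $\int_s^tg(\tau)d\tau\le c\sqrt{t-s}$, $0\le s\le t\le T$, with a constant $c=c_{\delta,T}$. Here $|\langle b(t)\psi,\psi\rangle|$ is the Euclidean norm of the vector $(\langle b_k(t)\psi,\psi\rangle)_{k=1}^d$. *)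

theory Defs
  imports "HOL-Analysis.Analysis"
begin

definition partial :: "'n::finite \<Rightarrow> (real^'n \<Rightarrow> complex) \<Rightarrow> real^'n \<Rightarrow> complex" where
  "partial i f x = vector_derivative (\<lambda>h. f (x + h *\<^sub>R axis i 1)) (at 0)"

text \<open>Multi-indices are encoded as lists of coordinate directions. For smooth functions the order
  of differentiation is irrelevant, so these are exactly the usual partial derivatives.\<close>

definition partials :: "'n::finite list \<Rightarrow> (real^'n \<Rightarrow> complex) \<Rightarrow> real^'n \<Rightarrow> complex" where
  "partials \<alpha> f = foldr partial \<alpha> f"

definition schwartz :: "(real^'n::finite \<Rightarrow> complex) set" where
  "schwartz = {f. (\<forall>\<alpha> x. partials \<alpha> f differentiable (at x)) \<and>
                  (\<forall>m \<alpha>. bdd_above (range (\<lambda>x. (1 + norm x) ^ m * norm (partials \<alpha> f x))))}"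

definition schwartz_seminorm :: "nat \<Rightarrow> 'n::finite list \<Rightarrow> (real^'n \<Rightarrow> complex) \<Rightarrow> real" where
  "schwartz_seminorm m \<alpha> f = (SUP x. (1 + norm x) ^ m * norm (partials \<alpha> f x))"

text \<open>The locally convex topology of the Schwartz space: the seminorm balls form a subbase.\<close>

definition schwartz_topology :: "(real^'n::finite \<Rightarrow> complex) topology" where
  "schwartz_topology = topology_generated_by
     {{g \<in> schwartz. schwartz_seminorm m \<alpha> (\<lambda>x. g x - f x) < e} | m \<alpha> f e.
        f \<in> schwartz \<and> 0 < e}"

type_synonym 'n functional = "(real^'n \<Rightarrow> complex) \<Rightarrow> complex"

text \<open>Only the values of a functional on Schwartz functions are meaningful.\<close>

definition tempered :: "'n::finite functional \<Rightarrow> bool" where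
  "tempered u \<longleftrightarrow>
     (\<forall>f\<in>schwartz. \<forall>g\<in>schwartz. u (\<lambda>x. f x + g x) = u f + u g) \<and>
     (\<forall>c. \<forall>f\<in>schwartz. u (\<lambda>x. c * f x) = c * u f) \<and>
     continuous_map schwartz_topology euclidean u"

definition dist_of :: "(real^'n::finite \<Rightarrow> complex) \<Rightarrow> 'n functional" where
  "dist_of f \<phi> = (LINT x|lebesgue. f x * \<phi> x)"

definition dist_partial :: "'n::finite \<Rightarrow> 'n functional \<Rightarrow> 'n functional" where
  "dist_partial i u \<phi> = - u (partial i \<phi>)"

definition dist_div :: "('n::finite \<Rightarrow> 'n functional) \<Rightarrow> 'n functional" where
  "dist_div u \<phi> = (\<Sum>k\<in>UNIV. dist_partial k (u k) \<phi>)"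

definition dist_mult :: "'n::finite functional \<Rightarrow> (real^'n \<Rightarrow> complex) \<Rightarrow> 'n functional" where
  "dist_mult u \<psi> \<phi> = u (\<lambda>x. \<psi> x * \<phi> x)"

text \<open>The extension to distributions \<open>u\<close> of the sesquilinear pairing
  \<open>\<langle>f, g\<rangle> = \<integral> f (cnj g)\<close>.\<close>

definition dist_pairing :: "'n::finite functional \<Rightarrow> (real^'n \<Rightarrow> complex) \<Rightarrow> complex" where
  "dist_pairing u \<psi> = u (\<lambda>x. cnj (\<psi> x))"

definition l2_norm :: "(real^'n::finite \<Rightarrow> 'b::real_normed_vector) \<Rightarrow> real" where
  "l2_norm f = sqrt (LINT x|lebesgue. (norm (f x))\<^sup>2)"

definition grad :: "(real^'n::finite \<Rightarrow> complex) \<Rightarrow> real^'n \<Rightarrow> complex^'n" where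
  "grad f x = (\<chi> i. partial i f x)"

definition cube :: "real^'n::finite \<Rightarrow> real \<Rightarrow> (real^'n) set" where
  "cube a l = cbox a (a + l *\<^sub>R One)"

definition mean_on :: "(real^'n::finite) set \<Rightarrow> (real^'n \<Rightarrow> 'b::euclidean_space) \<Rightarrow> 'b" where
  "mean_on Q f = (LINT x:Q|lebesgue. f x) /\<^sub>R measure lebesgue Q"

definition mean_oscillation :: "(real^'n::finite \<Rightarrow> complex) \<Rightarrow> (real^'n) set \<Rightarrow> real" where
  "mean_oscillation f Q = mean_on Q (\<lambda>x. norm (f x - mean_on Q f))"

definition BMO :: "(real^'n::finite \<Rightarrow> complex) set" where
  "BMO = {f. (\<forall>K. compact K \<longrightarrow> f absolutely_integrable_on K) \<and>
             bdd_above {mean_oscillation f (cube a l) | a l. 0 < l}}"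

definition BMO_norm :: "(real^'n::finite \<Rightarrow> complex) \<Rightarrow> real" where
  "BMO_norm f = Sup {mean_oscillation f (cube a l) | a l. 0 < l}"

text \<open>Functions of time and space on \<open>[0, \<infinity>[ \<times> \<real>\<^sup>d\<close>; values at negative times are irrelevant.
  Measurability in time is required in the form of joint measurability, since \<open>BMO\<close> is not
  separable.\<close>

definition spacetime_measurable :: "(real \<Rightarrow> real^'n::finite \<Rightarrow> complex) \<Rightarrow> bool" where
  "spacetime_measurable F \<longleftrightarrow>
     (\<lambda>(t, x). F t x) \<in> borel_measurable (lebesgue_on ({0..} \<times> UNIV))"

definition Linf_BMO :: "(real \<Rightarrow> real^'n::finite \<Rightarrow> complex) set" where
  "Linf_BMO = {F. spacetime_measurable F \<and>
     (\<exists>M. AE t in lebesgue_on {0..}. F t \<in> BMO \<and> BMO_norm (F t) \<le> M)}"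

definition Lloc :: "real \<Rightarrow> (real \<Rightarrow> real^'n::finite \<Rightarrow> complex) set" where
  "Lloc q = {F. spacetime_measurable F \<and>
     (\<forall>K. compact K \<and> K \<subseteq> {0..} \<times> UNIV \<longrightarrow>
        (\<lambda>(t, x). norm (F t x) powr q) absolutely_integrable_on K)}"

text \<open>Distributional vector fields \<open>b\<close> are given by their components \<open>b t k\<close> at times \<open>t \<ge> 0\<close>.\<close>

definition tempered_field :: "(real \<Rightarrow> 'n::finite \<Rightarrow> 'n functional) \<Rightarrow> bool" where
  "tempered_field b \<longleftrightarrow> (\<forall>t\<ge>0. \<forall>k. tempered (b t k))"

text \<open>As \<open>B\<close> is only determined up to null sets, identities at time \<open>t\<close> are meant for almost every
  \<open>t \<ge> 0\<close>.\<close>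

definition Linf_BMO_inv :: "(real \<Rightarrow> 'n::finite \<Rightarrow> 'n functional) set" where
  "Linf_BMO_inv = {b. tempered_field b \<and>
     (AE t in lebesgue_on {0..}. \<forall>\<phi>\<in>schwartz. dist_div (b t) \<phi> = 0) \<and>
     (\<exists>B :: real \<Rightarrow> real^'n \<Rightarrow> complex^'n^'n.
        (AE (t, x) in lebesgue_on ({0..} \<times> UNIV). transpose (B t x) = - B t x) \<and>
        (\<forall>i k. (\<lambda>t x. B t x $ i $ k) \<in> Linf_BMO) \<and>
        (\<forall>i k. \<forall>q\<ge>1. (\<lambda>t x. B t x $ i $ k) \<in> Lloc q) \<and>
        (AE t in lebesgue_on {0..}. \<forall>k. \<forall>\<phi>\<in>schwartz.
           b t k \<phi> = (\<Sum>i\<in>UNIV. dist_partial i (dist_of (\<lambda>x. B t x $ i $ k)) \<phi>)))}"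

definition M_class :: "real \<Rightarrow> (real \<Rightarrow> 'n::finite \<Rightarrow> 'n functional) set" where
  "M_class \<delta> = {b. tempered_field b \<and>
     (\<exists>g :: real \<Rightarrow> real.
        (\<forall>t\<ge>0. 0 \<le> g t) \<and>
        (\<forall>T\<ge>0. g absolutely_integrable_on {0..T} \<and>
           (\<exists>c. \<forall>s t. 0 \<le> s \<and> s \<le> t \<and> t \<le> T \<longrightarrow>
              (LINT \<tau>:{s..t}|lebesgue. g \<tau>) \<le> c * sqrt (t - s))) \<and>
        (AE t in lebesgue_on {0..}. \<forall>\<psi>\<in>schwartz.
           norm (\<chi> k. dist_pairing (dist_mult (b t k) \<psi>) \<psi>)
             \<le> \<delta> * l2_norm (grad \<psi>) * l2_norm \<psi> + g t * (l2_norm \<psi>)\<^sup>2))}"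

end

theory Submission
  imports Defs
begin

text \<open>
  Testing the \<open>k\<close>-th component of the field on \<open>w = \<bar>\<psi>\<bar>\<^sup>2\<close> gives, for almost every time, minus the sum over
  \<open>i\<close> of \<open>\<integral> B\<^sub>i\<^sub>k \<partial>\<^sub>i w\<close>. So everything follows, even with vanishing \<open>g\<close>, from one scalar inequality: if the
  mean oscillation of \<open>f\<close> is at most \<open>M\<close> on all cubes, then
  \<open>\<bar>\<integral> f \<partial>\<^sub>i w\<bar> \<le> C M \<parallel>\<psi>\<parallel> \<parallel>\<nabla>\<psi>\<parallel>\<close> in \<open>L\<^sup>2\<close> norms, with \<open>C\<close> depending on the dimension only
  (\<open>derivative_pairing_le\<close>). It expresses the duality of \<open>BMO\<close> with the Hardy space, in which the
  derivatives of \<open>w\<close> lie, but this special case has a direct proof.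

  As \<open>BMO\<close> has no intrinsic length scale, nothing is lost by proving
  \<open>\<bar>\<integral> f \<partial>\<^sub>i w\<bar> \<le> C M (\<parallel>\<psi>\<parallel>\<^sup>2 / h + \<parallel>\<psi>\<parallel> \<parallel>\<nabla>\<psi>\<parallel> + h \<parallel>\<nabla>\<psi>\<parallel>\<^sup>2)\<close> for every length \<open>h > 0\<close> and then
  choosing \<open>h\<close>: scales above \<open>h\<close> and below \<open>h\<close> are treated by different elementary means. Let \<open>A\<close> be the
  function that on each cell of a grid of mesh \<open>h\<close> is the mean of \<open>f\<close> over that cell.

  Large scales, \<open>\<integral> A \<partial>\<^sub>i w\<close> (\<open>cell_mean_derivative_pairing\<close>). Means over neighbouring cubes differ by
  \<open>O(M)\<close>. Therefore replacing \<open>A\<close> by its average over translations by \<open>s \<in> [0,h]\<close> in direction \<open>i\<close> costs only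
  \<open>O(M) \<integral> \<bar>\<partial>\<^sub>i w\<bar>\<close>. The average turns the derivative of \<open>w\<close> into a difference quotient of step \<open>h\<close>, which
  can be moved to \<open>A\<close>, and leaves \<open>O(M / h) \<integral> \<bar>w\<bar>\<close>.

  Small scales, \<open>\<integral> (f - A) \<partial>\<^sub>i w\<close>. Since \<open>\<bar>\<partial>\<^sub>i w\<bar> \<le> 2 \<bar>\<psi>\<bar> \<bar>\<nabla>\<psi>\<bar>\<close>, the Cauchy-Schwarz inequality reduces this
  term to \<open>\<parallel>(f - A) \<psi>\<parallel> \<le> C M (\<parallel>\<psi>\<parallel> + h \<parallel>\<nabla>\<psi>\<parallel>)\<close> (\<open>oscillation_multiplier\<close>). On a cell of mesh
  \<open>h / 2\<^sup>n\<close> the function \<open>f - A\<close> has mean square \<open>O(M\<^sup>2 (n + 1)\<^sup>2)\<close> by \<open>John_Nirenberg_square\<close>, while the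
  means of \<open>\<psi>\<close> over such cells differ from \<open>\<psi>\<close> by \<open>O(h 2\<^sup>-\<^sup>n \<parallel>\<nabla>\<psi>\<parallel>)\<close> in \<open>L\<^sup>2\<close> by \<open>Poincare_cells\<close>. The
  telescoping series of these means thus converges in the space weighted by \<open>\<bar>f - A\<bar>\<^sup>2\<close>.
\<close>

section \<open>Grids of half-open cubes\<close>

text \<open>Cells are half-open and indexed by integer vectors, so that a grid is a countable measurable
  partition of the whole space and the grid of half the mesh refines it.\<close>

definition grid_index :: "real \<Rightarrow> real^'n::finite \<Rightarrow> int^'n" where
  "grid_index h x = (\<chi> i. \<lfloor>x $ i / h\<rfloor>)"

definition cell :: "real \<Rightarrow> int^'n::finite \<Rightarrow> (real^'n) set" where
  "cell h z = {x. grid_index h x = z}"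

definition corner :: "real \<Rightarrow> int^'n::finite \<Rightarrow> real^'n" where
  "corner h z = (\<chi> i. h * of_int (z $ i))"

definition cell_mean :: "real \<Rightarrow> (real^'n::finite \<Rightarrow> complex) \<Rightarrow> real^'n \<Rightarrow> complex" where
  "cell_mean h f x = mean_on (cell h (grid_index h x)) f"

lemma sum_Basis_nth [simp]: "(\<Sum>b\<in>Basis. (b :: real^'n::finite) $ i) = 1"
proof -
  have "(\<Sum>b\<in>Basis. (b :: real^'n) $ i) = (\<Sum>b\<in>Basis. if b = (axis i 1 :: real^'n) then 1 else 0)"
    by (rule sum.cong) (auto simp: Basis_vec_def axis_def vec_eq_iff split: if_splits)
  then show ?thesis by (simp add: axis_in_Basis_iff)
qed

lemma mem_cube: "x \<in> cube a l \<longleftrightarrow> (\<forall>i. a $ i \<le> x $ i \<and> x $ i \<le> a $ i + l)"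
  by (simp add: cube_def mem_box_cart)

lemma mem_cell_iff:
  assumes "0 < h"
  shows "x \<in> cell h z \<longleftrightarrow> (\<forall>i. corner h z $ i \<le> x $ i \<and> x $ i < corner h z $ i + h)"
  using assms
  by (simp add: cell_def grid_index_def corner_def vec_eq_iff floor_eq_iff field_simps)

lemma cell_subset_cube: "0 < h \<Longrightarrow> cell h z \<subseteq> cube (corner h z) h"
  by (auto simp: mem_cell_iff mem_cube less_imp_le)

lemma in_own_cell: "x \<in> cell h (grid_index h x)"
  by (simp add: cell_def)

lemma content_cube: "0 < l \<Longrightarrow> measure lebesgue (cube a l :: (real^'n::finite) set) = l ^ CARD('n)"
  unfolding cube_def
  by (simp add: content_cbox_cart interval_ne_empty_cart)

lemma emeasure_cube:
  assumes "0 < l"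
  shows "emeasure lborel (cube a l :: (real^'n::finite) set) = ennreal (l ^ CARD('n))"
proof -
  have "emeasure lborel (cube a l) < \<infinity>"
    unfolding cube_def by (rule emeasure_lborel_cbox_finite)
  then show ?thesis
    using content_cube[OF assms, of a] by (simp add: emeasure_eq_ennreal_measure cube_def)
qed

lemma cube_diff_cell_null:
  assumes "0 < h"
  shows "cube (corner h z) h - cell h z \<in> null_sets lebesgue"
proof -
  have "cube (corner h z) h - cell h z \<subseteq> cbox (corner h z) (corner h z + h *\<^sub>R One)
      - box (corner h z) (corner h z + h *\<^sub>R One)"
    using assms by (force simp: cube_def mem_cell_iff mem_box_cart less_imp_le)
  then show ?thesis
    by (meson negligible_iff_null_sets negligible_frontier_interval negligible_subset)
qed

lemma cube_measurable [measurable, simp]: "cube a l \<in> sets lebesgue"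
  by (simp add: cube_def)

lemma grid_index_measurable [measurable]:
  "grid_index h \<in> borel \<rightarrow>\<^sub>M count_space (UNIV :: (int^'n::finite) set)"
proof -
  have "(grid_index h -` {z} \<inter> space borel) = {x. \<forall>i. \<lfloor>x $ i / h\<rfloor> = z $ i}" for z :: "int^'n"
    by (auto simp: grid_index_def vec_eq_iff)
  moreover have "{x::real^'n. \<forall>i. \<lfloor>x $ i / h\<rfloor> = z $ i} \<in> sets borel" for z :: "int^'n"
    by measurable
  ultimately show ?thesis
    by (subst measurable_count_space_eq2_countable) auto
qed

lemma cell_borel [measurable]: "cell h z \<in> sets borel"
proof -
  have "grid_index h -` {z} \<inter> space borel \<in> sets borel"
    by (rule measurable_sets[OF grid_index_measurable]) simp
  then show ?thesis by (simp add: cell_def vimage_def)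
qed

lemma cell_lebesgue [measurable, simp]: "cell h z \<in> sets lebesgue"
  using cell_borel by (metis sets_completionI_sets sets_lborel)

lemma measure_cell:
  assumes "0 < h"
  shows "measure lborel (cell h z :: (real^'n::finite) set) = h ^ CARD('n)"
proof -
  have "measure lebesgue (cell h z)
      = measure lebesgue (cube (corner h z) h - (cube (corner h z) h - cell h z))"
    using cell_subset_cube[OF assms, of z] by (simp add: double_diff)
  also have "\<dots> = measure lebesgue (cube (corner h z) h)"
    by (rule measure_Diff_null_set[OF cube_measurable cube_diff_cell_null[OF assms]])
  finally show ?thesis using content_cube[OF assms, of "corner h z"] by simp
qed

lemma emeasure_cell:
  assumes "0 < h"
  shows "emeasure lebesgue (cell h z :: (real^'n::finite) set) = ennreal (h ^ CARD('n))"
proof -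
  have "emeasure lebesgue (cell h z) \<le> emeasure lebesgue (cube (corner h z) h)"
    by (rule emeasure_mono) (use cell_subset_cube assms in auto)
  also have "\<dots> < \<infinity>"
    by (simp add: cube_def emeasure_lborel_cbox_eq)
  finally show ?thesis
    using measure_cell[OF assms, of z] by (simp add: emeasure_eq_ennreal_measure)
qed

text \<open>Cells serve for partitions while \<open>BMO\<close> is defined by closed cubes; the two differ by a null
  set. The equation includes the case where neither side is integrable.\<close>

lemma set_integral_cell:
  fixes f :: "real^'n::finite \<Rightarrow> 'b::euclidean_space"
  assumes "0 < h"
  shows "(LINT x:cell h z|lebesgue. f x) = (LINT x:cube (corner h z) h|lebesgue. f x)"
  unfolding set_lebesgue_integral_def
proof (cases "integrable lebesgue (\<lambda>x. indicator (cube (corner h z) h) x *\<^sub>R f x)")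
  have ae: "AE x in lebesgue. indicator (cell h z) x *\<^sub>R f x = indicator (cube (corner h z) h) x *\<^sub>R f x"
    using AE_not_in[OF cube_diff_cell_null[OF assms, of z]]
    by eventually_elim (use cell_subset_cube[OF assms, of z] in \<open>auto simp: indicator_def\<close>)
  { case True
    have "(\<lambda>x. indicator (cell h z) x *\<^sub>R (indicator (cube (corner h z) h) x *\<^sub>R f x))
        \<in> borel_measurable lebesgue"
      using True by measurable
    moreover have "(\<lambda>x. indicator (cell h z) x *\<^sub>R (indicator (cube (corner h z) h) x *\<^sub>R f x))
        = (\<lambda>x. indicator (cell h z) x *\<^sub>R f x)"
      using cell_subset_cube[OF assms, of z] by (auto simp: indicator_def fun_eq_iff)
    ultimately have "(\<lambda>x. indicator (cell h z) x *\<^sub>R f x) \<in> borel_measurable lebesgue"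
      by simp
    then show "(LINT x|lebesgue. indicator (cell h z) x *\<^sub>R f x)
        = (LINT x|lebesgue. indicator (cube (corner h z) h) x *\<^sub>R f x)"
      using True ae by (intro integral_cong_AE) auto }
  { case False
    have "\<not> integrable lebesgue (\<lambda>x. indicator (cell h z) x *\<^sub>R f x)"
    proof
      assume i: "integrable lebesgue (\<lambda>x. indicator (cell h z) x *\<^sub>R f x)"
      have m: "(\<lambda>x. indicator (cube (corner h z) h) x *\<^sub>R f x) \<in> borel_measurable lebesgue"
        by (rule borel_measurable_AE[OF borel_measurable_integrable[OF i] ae])
      have "integrable lebesgue (\<lambda>x. indicator (cube (corner h z) h) x *\<^sub>R f x)"
        by (rule integrable_cong_AE_imp[OF i m]) (use ae in \<open>auto elim: eventually_mono\<close>)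
      with False show False ..
    qed
    with False show "(LINT x|lebesgue. indicator (cell h z) x *\<^sub>R f x)
        = (LINT x|lebesgue. indicator (cube (corner h z) h) x *\<^sub>R f x)"
      by (simp add: not_integrable_integral_eq) }
qed

lemma mean_on_cell:
  assumes "0 < h"
  shows "mean_on (cell h z) f = mean_on (cube (corner h z) h) f"
  using content_cube[OF assms, of "corner h z"]
  by (simp add: mean_on_def set_integral_cell[OF assms] measure_cell[OF assms])

lemma nn_integral_sum_cells:
  fixes F :: "real^'n::finite \<Rightarrow> ennreal"
  assumes [measurable]: "F \<in> borel_measurable lebesgue"
  shows "(\<integral>\<^sup>+x. F x \<partial>lebesgue) = (\<integral>\<^sup>+z. (\<integral>\<^sup>+x\<in>cell h z. F x \<partial>lebesgue) \<partial>count_space UNIV)"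
proof -
  have "(\<integral>\<^sup>+x. F x \<partial>lebesgue) = emeasure (density lebesgue F) (\<Union>z\<in>UNIV. cell h z)"
    by (subst emeasure_density) (auto simp: cell_def intro!: nn_integral_cong)
  also have "\<dots> = (\<integral>\<^sup>+z. emeasure (density lebesgue F) (cell h z) \<partial>count_space UNIV)"
    by (rule emeasure_UN_countable) (auto simp: disjoint_family_on_def cell_def cell_lebesgue[unfolded cell_def])
  also have "\<dots> = (\<integral>\<^sup>+z. (\<integral>\<^sup>+x\<in>cell h z. F x \<partial>lebesgue) \<partial>count_space UNIV)"
    by (intro nn_integral_cong) (simp add: emeasure_density)
  finally show ?thesis .
qed

text \<open>Nonnegative integrals over the whole space are compared one cell at a time. Halving of a
  cell, inequalities against functions constant on cells and summation over all cells are all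
  instances, which avoids explicit sums over subcubes.\<close>

lemma nn_integral_mono_cells:
  fixes F G :: "real^'n::finite \<Rightarrow> ennreal"
  assumes "F \<in> borel_measurable lebesgue" "G \<in> borel_measurable lebesgue"
    and "\<And>z. (\<integral>\<^sup>+x\<in>cell h z. F x \<partial>lebesgue) \<le> (\<integral>\<^sup>+x\<in>cell h z. G x \<partial>lebesgue)"
  shows "(\<integral>\<^sup>+x. F x \<partial>lebesgue) \<le> (\<integral>\<^sup>+x. G x \<partial>lebesgue)"
  unfolding nn_integral_sum_cells[OF assms(1), where h = h] nn_integral_sum_cells[OF assms(2), where h = h]
  by (rule nn_integral_mono) (rule assms(3))

lemma grid_index_double: "grid_index (2 * h) x = (\<chi> i. grid_index h x $ i div 2)"
proof -
  have "\<lfloor>x $ i / (2 * h)\<rfloor> = \<lfloor>x $ i / h\<rfloor> div 2" for i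
    using floor_divide_real_eq_div[of 2 "x $ i / h"] by (simp add: mult.commute)
  then show ?thesis by (simp add: grid_index_def)
qed

lemma cell_subset_parent: "cell h z \<subseteq> cell (2 * h) (\<chi> i. z $ i div 2)"
  by (auto simp: cell_def grid_index_double)

lemma cells_disjoint_or_nested:
  "cell h y \<subseteq> cell (2 * h) z \<or> cell h y \<inter> cell (2 * h) z = {}"
  by (auto simp: cell_def grid_index_double)

lemma cell_mean_eq: "x \<in> cell h z \<Longrightarrow> cell_mean h f x = mean_on (cell h z) f"
  by (simp add: cell_mean_def cell_def)

lemma cell_mean_measurable [measurable]: "cell_mean h f \<in> borel_measurable borel"
  unfolding cell_mean_def
  by (rule measurable_compose[OF grid_index_measurable]) simp

lemma cell_mean_measurable_lebesgue [measurable]: "cell_mean h f \<in> borel_measurable lebesgue"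
  using cell_mean_measurable[of h f] by (simp add: measurable_completion)

section \<open>Functions of bounded mean oscillation\<close>

lemma square_sum_le: "(a + b)\<^sup>2 \<le> 2 * a\<^sup>2 + 2 * b\<^sup>2" for a b :: real
  using sum_squares_bound[of a b] by (simp add: power2_sum)

lemma norm_mean_on_diff_le:
  fixes f :: "real^'n::finite \<Rightarrow> 'b::euclidean_space"
  assumes f: "f absolutely_integrable_on S" and S: "S \<in> lmeasurable" "0 < measure lebesgue S"
  shows "measure lebesgue S * norm (mean_on S f - c) \<le> (LINT x:S|lebesgue. norm (f x - c))"
proof -
  note const = absolutely_integrable_on_const[OF S(1)]
  have "(LINT x:S|lebesgue. f x - c) = (LINT x:S|lebesgue. f x) - (LINT x:S|lebesgue. c)"
    by (rule set_integral_diff(2)[OF f const])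
  also have "(LINT x:S|lebesgue. c) = measure lebesgue S *\<^sub>R c"
    using const[of "1 :: real"] S by (simp add: set_lebesgue_integral_def set_integrable_def)
  finally have "(LINT x:S|lebesgue. f x - c) = measure lebesgue S *\<^sub>R (mean_on S f - c)"
    using S by (simp add: mean_on_def scaleR_diff_right)
  then have "measure lebesgue S * norm (mean_on S f - c) = norm (LINT x:S|lebesgue. f x - c)"
    by simp
  also have "\<dots> \<le> (LINT x:S|lebesgue. norm (f x - c))"
    using set_integral_norm_bound[OF set_integral_diff(1)[OF f const]] .
  finally show ?thesis .
qed

text \<open>The number \<open>D\<close> is the ratio of the volumes of a cube and of a cube of half its side. It is a
  parameter so that constants depend on \<open>M\<close> and \<open>D\<close> alone and can be chosen before \<open>f\<close>.\<close>

locale bounded_mean_oscillation =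
  fixes f :: "real^'n::finite \<Rightarrow> complex" and M D :: real
  assumes M_pos: "0 < M"
    and D_eq: "D = 2 ^ CARD('n)"
    and loc_integrable: "\<And>K. compact K \<Longrightarrow> f absolutely_integrable_on K"
    and oscillation_le: "\<And>a l. 0 < l \<Longrightarrow> mean_oscillation f (cube a l) \<le> M"
begin

lemma integrable_cube: "f absolutely_integrable_on cube a l"
  by (simp add: cube_def loc_integrable)

lemma integrable_subset:
  "S \<subseteq> cube a l \<Longrightarrow> S \<in> sets lebesgue \<Longrightarrow> f absolutely_integrable_on S"
  using set_integrable_subset[OF integrable_cube] by blast

lemma f_measurable [measurable]: "f \<in> borel_measurable lebesgue"
proof (rule borel_measurable_LIMSEQ_metric)
  show "(\<lambda>x. indicator (cbox (- real k *\<^sub>R One) (real k *\<^sub>R One)) x *\<^sub>R f x) \<in> borel_measurable lebesgue" for k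
    using loc_integrable[of "cbox (- real k *\<^sub>R One) (real k *\<^sub>R One)"]
    by (auto simp: set_integrable_def dest: borel_measurable_integrable)
  show "(\<lambda>k. indicator (cbox (- real k *\<^sub>R One) (real k *\<^sub>R One)) x *\<^sub>R f x) \<longlonglongrightarrow> f x" for x
  proof (rule tendsto_eventually, rule eventually_sequentiallyI)
    fix k assume "nat \<lceil>norm x\<rceil> \<le> k"
    then have "\<bar>x $ i\<bar> \<le> real k" for i
      using component_le_norm_cart[of x i] by linarith
    then show "indicator (cbox (- real k *\<^sub>R One) (real k *\<^sub>R One)) x *\<^sub>R f x = f x"
      by (auto simp: indicator_def mem_box_cart abs_le_iff minus_le_iff)
  qed
qed

lemma lmeasurable_subset_cube: "S \<subseteq> cube a l \<Longrightarrow> S \<in> sets lebesgue \<Longrightarrow> S \<in> lmeasurable"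
  by (rule fmeasurableI2[of "cube a l"]) (auto simp: cube_def)

lemma const_integrable:
  "S \<subseteq> cube a l \<Longrightarrow> S \<in> sets lebesgue \<Longrightarrow> (\<lambda>_. c :: 'b::euclidean_space) absolutely_integrable_on S"
  by (simp add: lmeasurable_subset_cube)

lemma norm_diff_integrable:
  assumes "S \<subseteq> cube a l" "S \<in> sets lebesgue"
  shows "(\<lambda>x. norm (f x - c)) absolutely_integrable_on S"
  using set_integral_diff(1)[OF integrable_subset[OF assms] const_integrable[OF assms]]
  by (rule set_integrable_norm)

lemma norm_mean_diff_le:
  assumes "S \<subseteq> cube a l" "S \<in> sets lebesgue" "0 < measure lebesgue S"
  shows "measure lebesgue S * norm (mean_on S f - c) \<le> (LINT x:S|lebesgue. norm (f x - c))"
  using assms integrable_subset lmeasurable_subset_cube by (intro norm_mean_on_diff_le) auto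

lemma integral_oscillation_cube:
  assumes "0 < l"
  shows "(LINT x:cube a l|lebesgue. norm (f x - mean_on (cube a l) f)) \<le> M * l ^ CARD('n)"
  using oscillation_le[OF assms, of a] assms content_cube[OF assms, of a]
  by (simp add: mean_oscillation_def mean_on_def field_simps)

text \<open>The mean oscillation over a cube controls the mean over any part of it, at the price of the
  ratio of volumes. All comparisons of means below come from this.\<close>

lemma mean_subset_diff:
  assumes "0 < l" "S \<subseteq> cube a l" "S \<in> sets lebesgue" "0 < measure lebesgue S"
  shows "norm (mean_on S f - mean_on (cube a l) f) \<le> M * l ^ CARD('n) / measure lebesgue S"
proof -
  let ?c = "mean_on (cube a l) f"
  have "measure lebesgue S * norm (mean_on S f - ?c) \<le> (LINT x:S|lebesgue. norm (f x - ?c))"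
    by (rule norm_mean_diff_le[OF assms(2-4)])
  also have "\<dots> \<le> (LINT x:cube a l|lebesgue. norm (f x - ?c))"
    unfolding set_lebesgue_integral_def
    using norm_diff_integrable[OF order_refl cube_measurable, of a l ?c]
      norm_diff_integrable[OF assms(2,3), of ?c] assms(2)
    by (intro integral_mono) (auto simp: set_integrable_def indicator_def)
  also have "\<dots> \<le> M * l ^ CARD('n)"
    by (rule integral_oscillation_cube[OF assms(1)])
  finally show ?thesis
    using assms(4) by (simp add: field_simps)
qed

text \<open>Both cubes lie in a common cube of twice the side.\<close>

lemma mean_neighbour_cubes:
  assumes "0 < l" and near: "\<And>i. \<bar>a $ i - b $ i\<bar> \<le> l"
  shows "norm (mean_on (cube a l) f - mean_on (cube b l) f) \<le> 2 * (D * M)"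
proof -
  define c :: "real^'n" where "c = (\<chi> i. min (a $ i) (b $ i))"
  have sub: "cube a l \<subseteq> cube c (2 * l)" "cube b l \<subseteq> cube c (2 * l)"
    using near by (auto simp: subset_iff mem_cube c_def min_def abs_le_iff; smt (verit))+
  have *: "norm (mean_on (cube d l) f - mean_on (cube c (2 * l)) f) \<le> D * M"
    if "cube d l \<subseteq> cube c (2 * l)" for d
    using mean_subset_diff[OF _ that] assms(1) content_cube[OF assms(1), of d]
    by (simp add: D_eq power_mult_distrib field_simps)
  show ?thesis
    using norm_triangle_ineq4[of "mean_on (cube a l) f - mean_on (cube c (2 * l)) f"
        "mean_on (cube b l) f - mean_on (cube c (2 * l)) f"] *[OF sub(1)] *[OF sub(2)]
    by simp
qed

lemma mean_nested_cells:
  assumes "0 < h" "cell h y \<subseteq> cell (2 * h) z"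
  shows "norm (mean_on (cell h y) f - mean_on (cell (2 * h) z) f) \<le> D * M"
proof -
  have "cell h y \<subseteq> cube (corner (2 * h) z) (2 * h)"
    using assms cell_subset_cube[of "2 * h" z] by auto
  from mean_subset_diff[OF _ this] assms(1)
  have "norm (mean_on (cell h y) f - mean_on (cube (corner (2 * h) z) (2 * h)) f)
      \<le> M * (2 * h) ^ CARD('n) / h ^ CARD('n)"
    by (simp add: measure_cell)
  then show ?thesis
    using assms(1) mean_on_cell[of "2 * h" z f] by (simp add: D_eq power_mult_distrib mult.commute)
qed

lemma integral_oscillation_cell:
  assumes "0 < h"
  shows "(LINT x:cell h z|lebesgue. norm (f x - mean_on (cell h z) f)) \<le> M * h ^ CARD('n)"
  using integral_oscillation_cube[OF assms, of "corner h z"]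
  by (simp add: set_integral_cell assms mean_on_cell)

text \<open>Passes from nonnegative integrals, in which cells are summed, to real ones, in which mean
  oscillations are given.\<close>

lemma nn_integral_affine_cell:
  assumes "0 < h" "0 \<le> A" "0 \<le> B"
  shows "(\<integral>\<^sup>+x\<in>cell h z. ennreal (A * norm (f x - c) + B) \<partial>lebesgue)
    = ennreal (A * (LINT x:cell h z|lebesgue. norm (f x - c)) + B * h ^ CARD('n))"
proof -
  note sub = cell_subset_cube[OF assms(1), of z]
  have i: "set_integrable lebesgue (cell h z) (\<lambda>x. A * norm (f x - c) + B)"
    by (intro set_integral_add(1) set_integrable_mult_right impI
        norm_diff_integrable[OF sub] const_integrable[OF sub]) auto
  have "(\<integral>\<^sup>+x\<in>cell h z. ennreal (A * norm (f x - c) + B) \<partial>lebesgue)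
      = (\<integral>\<^sup>+x. ennreal (indicator (cell h z) x *\<^sub>R (A * norm (f x - c) + B)) \<partial>lebesgue)"
    by (intro nn_integral_cong) (simp add: indicator_def)
  also have "\<dots> = ennreal (LINT x:cell h z|lebesgue. A * norm (f x - c) + B)"
    unfolding set_lebesgue_integral_def
    by (rule nn_integral_eq_integral)
      (use i assms in \<open>auto simp: set_integrable_def indicator_def\<close>)
  also have "(LINT x:cell h z|lebesgue. A * norm (f x - c) + B)
      = (LINT x:cell h z|lebesgue. A * norm (f x - c)) + (LINT x:cell h z|lebesgue. B)"
    by (intro set_integral_add(2) set_integrable_mult_right impI
        norm_diff_integrable[OF sub] const_integrable[OF sub]) auto
  also have "(LINT x:cell h z|lebesgue. B) = B * h ^ CARD('n)"
    by (simp add: set_lebesgue_integral_def measure_cell assms(1))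
  finally show ?thesis by simp
qed

section \<open>A John-Nirenberg inequality in mean square\<close>

lemma D_ge_1: "1 \<le> D"
  by (simp add: D_eq)

text \<open>The constant solves \<open>2 (JN_slope M + 16 M\<^sup>2 + ((4 + D) M)\<^sup>2) = 4 M JN_slope + 16 M\<^sup>2\<close>, the balance needed
  in the induction step below.\<close>

abbreviation JN_slope :: real where "JN_slope \<equiv> (8 + (4 + D)\<^sup>2) * M"

lemma JN_slope_pos: "0 < JN_slope"
  using M_pos by (simp add: add_pos_nonneg)

lemma D_nonneg: "0 \<le> D"
  using D_ge_1 by simp

text \<open>Both sides are additive over the halved cells, so the induction on the number of halvings can
  estimate each of them separately. If the mean over a halved cell stays within \<open>4 M\<close> of
  \<open>c\<close>, the induction hypothesis applies with the same \<open>c\<close>. Otherwise one restarts from the mean \<open>c'\<close>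
  over that cell: \<open>\<bar>c' - c\<bar>\<close> is at most \<open>(4 + D) M\<close>, and this loss is paid by the term with
  \<open>\<bar>f - c\<bar>\<close>, whose mean over the cell exceeds \<open>4 M\<close>, whereas that of \<open>\<bar>f - c'\<bar>\<close> is at most \<open>M\<close>.\<close>

lemma cell_mean_deviation:
  assumes "0 < h" "norm (mean_on (cell (2 ^ k * h) z) f - c) \<le> 4 * M"
  shows "(\<integral>\<^sup>+x\<in>cell (2 ^ k * h) z. ennreal ((norm (cell_mean h f x - c))\<^sup>2) \<partial>lebesgue)
    \<le> (\<integral>\<^sup>+x\<in>cell (2 ^ k * h) z. ennreal (JN_slope * norm (f x - c) + 16 * M\<^sup>2) \<partial>lebesgue)"
  using assms(2)
proof (induction k arbitrary: z c)
  case 0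
  show ?case
  proof (intro nn_integral_mono)
    fix x
    have "(norm (cell_mean h f x - c))\<^sup>2 \<le> JN_slope * norm (f x - c) + 16 * M\<^sup>2" if "x \<in> cell h z"
    proof -
      have "(norm (cell_mean h f x - c))\<^sup>2 \<le> (4 * M)\<^sup>2"
        using 0 that by (intro power_mono) (simp_all add: cell_mean_eq)
      also have "\<dots> = 16 * M\<^sup>2" by (simp add: power2_eq_square)
      finally show ?thesis using JN_slope_pos by (simp add: add_increasing)
    qed
    then show "ennreal ((norm (cell_mean h f x - c))\<^sup>2) * indicator (cell (2 ^ 0 * h) z) x
        \<le> ennreal (JN_slope * norm (f x - c) + 16 * M\<^sup>2) * indicator (cell (2 ^ 0 * h) z) x"
      by (auto simp: indicator_def ennreal_leI)
  qed
next
  case (Suc k)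
  define g where "g = 2 ^ k * h"
  have g: "0 < g" "2 ^ Suc k * h = 2 * g" "2 ^ k * h = g" using assms(1) by (simp_all add: g_def)
  let ?E = "\<lambda>c x. (norm (cell_mean h f x - c))\<^sup>2"
  let ?G = "\<lambda>c x. JN_slope * norm (f x - c) + 16 * M\<^sup>2"
  have child: "(\<integral>\<^sup>+x\<in>cell g y. ennreal (?E c x) \<partial>lebesgue) \<le> (\<integral>\<^sup>+x\<in>cell g y. ennreal (?G c x) \<partial>lebesgue)"
    if sub: "cell g y \<subseteq> cell (2 * g) z" for y
  proof (cases "norm (mean_on (cell g y) f - c) \<le> 4 * M")
    case True
    then show ?thesis using Suc.IH[of y c] g by simp
  next
    case False
    \<comment> \<open>The mean over the parent is within \<open>4 M\<close> of \<open>c\<close>, and halving moves it by at most \<open>D M\<close>.\<close>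
    define c' where "c' = mean_on (cell g y) f"
    have c'_c: "norm (c' - c) \<le> (4 + D) * M"
    proof -
      have "norm (c' - c) \<le> norm (c' - mean_on (cell (2 * g) z) f) + norm (mean_on (cell (2 * g) z) f - c)"
        using norm_triangle_ineq[of "c' - mean_on (cell (2 * g) z) f" "mean_on (cell (2 * g) z) f - c"] by simp
      also have "\<dots> \<le> D * M + 4 * M"
        using Suc.prems mean_nested_cells[OF g(1) sub] unfolding c'_def g by (rule add_mono[rotated])
      finally show ?thesis by (simp add: algebra_simps)
    qed
    have "ennreal (?E c x) \<le> 2 * ennreal (?E c' x) + ennreal (2 * ((4 + D) * M)\<^sup>2)" for x
    proof -
      have "norm (cell_mean h f x - c) \<le> norm (cell_mean h f x - c') + (4 + D) * M"
        using c'_c norm_triangle_ineq[of "cell_mean h f x - c'" "c' - c"] by simp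
      then have "?E c x \<le> (norm (cell_mean h f x - c') + (4 + D) * M)\<^sup>2"
        by (intro power_mono) auto
      also have "\<dots> \<le> 2 * ?E c' x + 2 * ((4 + D) * M)\<^sup>2"
        by (rule square_sum_le)
      finally show ?thesis
        by (subst (asm) ennreal_le_iff[symmetric]) (auto simp: ennreal_mult'' ennreal_plus)
    qed
    then have "(\<integral>\<^sup>+x\<in>cell g y. ennreal (?E c x) \<partial>lebesgue)
        \<le> (\<integral>\<^sup>+x. 2 * (ennreal (?E c' x) * indicator (cell g y) x)
              + ennreal (2 * ((4 + D) * M)\<^sup>2) * indicator (cell g y) x \<partial>lebesgue)"
      by (intro nn_integral_mono) (auto simp: indicator_def)
    also have "\<dots> = 2 * (\<integral>\<^sup>+x\<in>cell g y. ennreal (?E c' x) \<partial>lebesgue)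
        + ennreal (2 * ((4 + D) * M)\<^sup>2) * ennreal (g ^ CARD('n))"
      by (simp add: nn_integral_add nn_integral_cmult nn_integral_cmult_indicator emeasure_cell[OF g(1)])
    also have "\<dots> \<le> 2 * ennreal (JN_slope * (M * g ^ CARD('n)) + 16 * M\<^sup>2 * g ^ CARD('n))
        + ennreal (2 * ((4 + D) * M)\<^sup>2) * ennreal (g ^ CARD('n))"
    proof -
      have "(\<integral>\<^sup>+x\<in>cell g y. ennreal (?E c' x) \<partial>lebesgue) \<le> (\<integral>\<^sup>+x\<in>cell g y. ennreal (?G c' x) \<partial>lebesgue)"
        using Suc.IH[of y c'] M_pos g by (simp add: c'_def)
      also have "\<dots> \<le> ennreal (JN_slope * (M * g ^ CARD('n)) + 16 * M\<^sup>2 * g ^ CARD('n))"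
        using JN_slope_pos integral_oscillation_cell[OF g(1), of y]
        by (subst nn_integral_affine_cell[OF g(1)]) (auto simp: c'_def intro!: ennreal_leI mult_left_mono)
      finally show ?thesis by (intro add_mono mult_left_mono) auto
    qed
    also have "\<dots> = ennreal (JN_slope * (4 * M * g ^ CARD('n)) + 16 * M\<^sup>2 * g ^ CARD('n))"
    proof -
      have "2 * (JN_slope * (M * g ^ CARD('n)) + 16 * M\<^sup>2 * g ^ CARD('n))
          + 2 * ((4 + D) * M)\<^sup>2 * g ^ CARD('n)
        = JN_slope * (4 * M * g ^ CARD('n)) + 16 * M\<^sup>2 * g ^ CARD('n)"
        by (simp add: power2_eq_square algebra_simps)
      then show ?thesis
        using JN_slope_pos M_pos g
        by (simp add: ennreal_mult'[symmetric] ennreal_plus[symmetric] flip: ennreal_numeral del: ennreal_plus)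
    qed
    also have "\<dots> \<le> ennreal (JN_slope * (LINT x:cell g y|lebesgue. norm (f x - c)) + 16 * M\<^sup>2 * g ^ CARD('n))"
    proof (intro ennreal_leI add_right_mono mult_left_mono)
      have "4 * M * g ^ CARD('n) \<le> norm (c' - c) * g ^ CARD('n)"
        using False g by (intro mult_right_mono) (auto simp: c'_def)
      also have "\<dots> \<le> (LINT x:cell g y|lebesgue. norm (f x - c))"
        using norm_mean_diff_le[OF cell_subset_cube[OF g(1), of y], of c] g
        by (simp add: measure_cell c'_def mult.commute)
      finally show "4 * M * g ^ CARD('n) \<le> (LINT x:cell g y|lebesgue. norm (f x - c))" .
    qed (use JN_slope_pos in simp)
    also have "\<dots> = (\<integral>\<^sup>+x\<in>cell g y. ennreal (?G c x) \<partial>lebesgue)"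
      using JN_slope_pos by (subst nn_integral_affine_cell[OF g(1)]) auto
    finally show ?thesis .
  qed
  have "(\<integral>\<^sup>+x. ennreal (?E c x) * indicator (cell (2 * g) z) x \<partial>lebesgue)
      \<le> (\<integral>\<^sup>+x. ennreal (?G c x) * indicator (cell (2 * g) z) x \<partial>lebesgue)"
  proof (rule nn_integral_mono_cells[where h = g])
    fix y
    consider "cell g y \<subseteq> cell (2 * g) z" | "cell g y \<inter> cell (2 * g) z = {}"
      using cells_disjoint_or_nested by blast
    then show "(\<integral>\<^sup>+x\<in>cell g y. (ennreal (?E c x) * indicator (cell (2 * g) z) x) \<partial>lebesgue)
        \<le> (\<integral>\<^sup>+x\<in>cell g y. (ennreal (?G c x) * indicator (cell (2 * g) z) x) \<partial>lebesgue)"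
    proof cases
      case 1
      have "a * indicator (cell (2 * g) z) x * indicator (cell g y) x = a * indicator (cell g y) x"
        for a :: ennreal and x
        using 1 by (auto simp: indicator_def)
      with child[OF 1] show ?thesis by (simp only:)
    next
      case 2
      have "a * indicator (cell (2 * g) z) x * indicator (cell g y) x = 0"
        for a :: ennreal and x
        using 2 by (auto simp: indicator_def)
      then show ?thesis by (simp only: nn_integral_const mult_zero_left order_refl)
    qed
  qed measurable
  then show ?case by (simp only: g(2))
qed

text \<open>Lebesgue differentiation holds for the cubes with lower corner \<open>x\<close>. Such a cube meets
  the grid cell of the same side that contains \<open>x\<close>, so that passing to grid cells costs a bounded
  error. A bounded error is harmless for the inequality that follows.\<close>

lemma cell_mean_near:
  assumes "0 < h"
  shows "AE x in lebesgue. \<forall>\<^sub>F n in sequentially. norm (f x - cell_mean (h / 2 ^ n) f x) \<le> 3 * D * M"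
proof -
  have "f integrable_on cbox a b" for a b
    using loc_integrable[of "cbox a b"] by (simp add: set_lebesgue_integral_eq_integral)
  then obtain N where N: "negligible N"
    and conv: "\<And>x e. \<lbrakk>x \<notin> N; 0 < e\<rbrakk> \<Longrightarrow> \<exists>d>0. \<forall>r. 0 < r \<and> r < d \<longrightarrow>
        norm (integral (cbox x (x + r *\<^sub>R One)) f /\<^sub>R r ^ DIM(real^'n) - f x) < e"
    using integrable_ccontinuous_explicit[of f] by metis
  have "\<forall>\<^sub>F n in sequentially. norm (f x - cell_mean (h / 2 ^ n) f x) \<le> 3 * D * M" if "x \<notin> N" for x
  proof -
    obtain d where d: "0 < d" and near: "\<And>r. 0 < r \<Longrightarrow> r < d \<Longrightarrow>
        norm (integral (cbox x (x + r *\<^sub>R One)) f /\<^sub>R r ^ DIM(real^'n) - f x) < M"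
      using conv[OF \<open>x \<notin> N\<close> M_pos] by blast
    have "(\<lambda>n. h / 2 ^ n) \<longlonglongrightarrow> 0"
      by (rule LIMSEQ_divide_realpow_zero) simp
    then have "\<forall>\<^sub>F n in sequentially. h / 2 ^ n < d"
      using d by (rule order_tendstoD)
    then show ?thesis
    proof eventually_elim
      fix n assume n: "h / 2 ^ n < d"
      define r where "r = h / 2 ^ n"
      have r: "0 < r" "r < d" using assms n by (simp_all add: r_def)
      let ?m = "mean_on (cube x r) f" and ?z = "grid_index r x"
      have "?m = integral (cbox x (x + r *\<^sub>R One)) f /\<^sub>R r ^ DIM(real^'n)"
        using content_cube[OF r(1), of x] set_lebesgue_integral_eq_integral(2)[OF integrable_cube[of x r]]
        by (simp add: mean_on_def cube_def)
      then have 1: "norm (?m - f x) \<le> M"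
        using near[OF r] by simp
      have "\<bar>x $ i - corner r ?z $ i\<bar> \<le> r" for i
        using in_own_cell[of x r] mem_cell_iff[OF r(1)] by (smt (verit))
      then have 2: "norm (?m - mean_on (cube (corner r ?z) r) f) \<le> 2 * (D * M)"
        by (rule mean_neighbour_cubes[OF r(1)])
      have "norm (f x - cell_mean r f x) \<le> M + 2 * (D * M)"
        using 1 2 norm_triangle_ineq[of "f x - ?m" "?m - mean_on (cube (corner r ?z) r) f"]
        by (simp add: cell_mean_def mean_on_cell[OF r(1)] norm_minus_commute)
      also have "\<dots> \<le> 3 * D * M"
        using M_pos D_ge_1 mult_right_mono[of 1 D M] by simp
      finally show "norm (f x - cell_mean (h / 2 ^ n) f x) \<le> 3 * D * M" by (simp add: r_def)
    qed
  qed
  then show ?thesis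
    using N by (auto simp: negligible_iff_null_sets intro!: AE_I'[of N])
qed

abbreviation JN_const :: real where
  "JN_const \<equiv> 2 * (8 + (4 + D)\<^sup>2) + 32 + 18 * D\<^sup>2"

text \<open>The deviation of the cell means of mesh \<open>h / 2\<^sup>n\<close> is bounded uniformly in \<open>n\<close>; Fatou's lemma
  transfers the bound to \<open>f\<close>.\<close>

theorem John_Nirenberg_square:
  assumes "0 < h"
  shows "(\<integral>\<^sup>+x\<in>cell h z. ennreal ((norm (f x - mean_on (cell h z) f))\<^sup>2) \<partial>lebesgue)
    \<le> ennreal (JN_const * M\<^sup>2 * h ^ CARD('n))"
proof -
  define c where "c = mean_on (cell h z) f"
  let ?E = "\<lambda>n x. 2 * (norm (cell_mean (h / 2 ^ n) f x - c))\<^sup>2 + 2 * (3 * D * M)\<^sup>2"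
  have "AE x in lebesgue. ennreal ((norm (f x - c))\<^sup>2) * indicator (cell h z) x
      \<le> liminf (\<lambda>n. ennreal (?E n x) * indicator (cell h z) x)"
    using cell_mean_near[OF assms]
  proof eventually_elim
    fix x assume "\<forall>\<^sub>F n in sequentially. norm (f x - cell_mean (h / 2 ^ n) f x) \<le> 3 * D * M"
    then have "\<forall>\<^sub>F n in sequentially. ennreal ((norm (f x - c))\<^sup>2) * indicator (cell h z) x
        \<le> ennreal (?E n x) * indicator (cell h z) x"
    proof eventually_elim
      fix n assume near: "norm (f x - cell_mean (h / 2 ^ n) f x) \<le> 3 * D * M"
      have "norm (f x - c) \<le> norm (cell_mean (h / 2 ^ n) f x - c) + 3 * D * M"
        using near norm_triangle_ineq[of "f x - cell_mean (h / 2 ^ n) f x" "cell_mean (h / 2 ^ n) f x - c"]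
        by simp
      then have "(norm (f x - c))\<^sup>2 \<le> (norm (cell_mean (h / 2 ^ n) f x - c) + 3 * D * M)\<^sup>2"
        by (intro power_mono) auto
      also have "\<dots> \<le> ?E n x" by (rule square_sum_le)
      finally show "ennreal ((norm (f x - c))\<^sup>2) * indicator (cell h z) x
          \<le> ennreal (?E n x) * indicator (cell h z) x"
        by (intro mult_right_mono ennreal_leI) auto
    qed
    then show "ennreal ((norm (f x - c))\<^sup>2) * indicator (cell h z) x
        \<le> liminf (\<lambda>n. ennreal (?E n x) * indicator (cell h z) x)"
      by (rule Liminf_bounded)
  qed
  then have "(\<integral>\<^sup>+x\<in>cell h z. ennreal ((norm (f x - c))\<^sup>2) \<partial>lebesgue)
      \<le> (\<integral>\<^sup>+x. liminf (\<lambda>n. ennreal (?E n x) * indicator (cell h z) x) \<partial>lebesgue)"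
    by (rule nn_integral_mono_AE)
  also have "\<dots> \<le> liminf (\<lambda>n. \<integral>\<^sup>+x. ennreal (?E n x) * indicator (cell h z) x \<partial>lebesgue)"
    by (rule nn_integral_liminf) measurable
  also have "\<dots> \<le> liminf (\<lambda>n :: nat. ennreal (JN_const * M\<^sup>2 * h ^ CARD('n)))"
  proof (rule Liminf_mono, rule always_eventually, rule allI)
    fix n
    have split: "ennreal (?E n x) = 2 * ennreal ((norm (cell_mean (h / 2 ^ n) f x - c))\<^sup>2)
        + ennreal (2 * (3 * D * M)\<^sup>2)" for x
      by (simp add: ennreal_mult'')
    have "(\<integral>\<^sup>+x. ennreal (?E n x) * indicator (cell h z) x \<partial>lebesgue)
        = 2 * (\<integral>\<^sup>+x\<in>cell h z. ennreal ((norm (cell_mean (h / 2 ^ n) f x - c))\<^sup>2) \<partial>lebesgue)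
          + ennreal (2 * (3 * D * M)\<^sup>2) * ennreal (h ^ CARD('n))"
      unfolding split
      by (simp add: distrib_right nn_integral_add nn_integral_cmult nn_integral_cmult_indicator
          emeasure_cell[OF assms] mult.assoc)
    also have "\<dots> \<le> 2 * ennreal (JN_slope * (M * h ^ CARD('n)) + 16 * M\<^sup>2 * h ^ CARD('n))
          + ennreal (2 * (3 * D * M)\<^sup>2) * ennreal (h ^ CARD('n))"
    proof -
      have "(\<integral>\<^sup>+x\<in>cell h z. ennreal ((norm (cell_mean (h / 2 ^ n) f x - c))\<^sup>2) \<partial>lebesgue)
          \<le> (\<integral>\<^sup>+x\<in>cell h z. ennreal (JN_slope * norm (f x - c) + 16 * M\<^sup>2) \<partial>lebesgue)"
        using cell_mean_deviation[of "h / 2 ^ n" n z c] assms M_pos by (simp add: c_def)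
      also have "\<dots> \<le> ennreal (JN_slope * (M * h ^ CARD('n)) + 16 * M\<^sup>2 * h ^ CARD('n))"
        using JN_slope_pos integral_oscillation_cell[OF assms, of z]
        by (subst nn_integral_affine_cell[OF assms]) (auto simp: c_def intro!: ennreal_leI mult_left_mono)
      finally show ?thesis by (intro add_mono mult_left_mono) auto
    qed
    also have "\<dots> = ennreal (JN_const * M\<^sup>2 * h ^ CARD('n))"
    proof -
      have "2 * (JN_slope * (M * h ^ CARD('n)) + 16 * M\<^sup>2 * h ^ CARD('n))
          + 2 * (3 * D * M)\<^sup>2 * h ^ CARD('n) = JN_const * M\<^sup>2 * h ^ CARD('n)"
        by (simp add: power2_eq_square algebra_simps)
      then show ?thesis
        using JN_slope_pos M_pos assms
        by (simp add: ennreal_mult'[symmetric] ennreal_plus[symmetric] flip: ennreal_numeral del: ennreal_plus)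
    qed
    finally show "(\<integral>\<^sup>+x. ennreal (?E n x) * indicator (cell h z) x \<partial>lebesgue)
        \<le> ennreal (JN_const * M\<^sup>2 * h ^ CARD('n))" .
  qed
  finally show ?thesis by (simp add: c_def Liminf_const)
qed

end

section \<open>A Poincare inequality on cells\<close>

lemma nn_integral_translate:
  fixes F :: "'a::euclidean_space \<Rightarrow> ennreal"
  assumes [measurable]: "F \<in> borel_measurable borel"
  shows "(\<integral>\<^sup>+x. F (x + k) \<partial>lborel) = (\<integral>\<^sup>+x. F x \<partial>lborel)"
proof -
  have "(\<integral>\<^sup>+x. F x \<partial>lborel) = (\<integral>\<^sup>+x. F x \<partial>distr lborel borel ((+) k))"
    by (simp add: lborel_distr_plus)
  also have "\<dots> = (\<integral>\<^sup>+x. F (k + x) \<partial>lborel)"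
    by (subst nn_integral_distr) auto
  finally show ?thesis by (simp add: add.commute)
qed

lemma cell_lmeasurable: "0 < h \<Longrightarrow> cell h z \<in> lmeasurable"
  by (rule fmeasurableI2[of "cube (corner h z) h"]) (auto simp: cube_def cell_subset_cube[unfolded cube_def])

lemma continuous_integrable_cell:
  fixes f :: "real^'n::finite \<Rightarrow> 'b::euclidean_space"
  assumes "continuous_on UNIV f" "0 < h"
  shows "f absolutely_integrable_on cell h z"
proof -
  have "f absolutely_integrable_on cube (corner h z) h"
    unfolding cube_def using assms(1) continuous_on_subset by (intro absolutely_integrable_continuous) blast
  then show ?thesis
    by (rule set_integrable_subset) (use cell_subset_cube assms in auto)
qed

lemma partial_eq_derivative:
  assumes "(f has_derivative f') (at x)"
  shows "partial i f x = f' (axis i 1)"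
proof -
  interpret f': bounded_linear f' using assms by (rule has_derivative_bounded_linear)
  have "((\<lambda>h. f (x + h *\<^sub>R axis i 1)) has_derivative (\<lambda>h. f' (h *\<^sub>R axis i 1))) (at 0)"
    by (rule has_derivative_compose[where g = f and f = "\<lambda>h. x + h *\<^sub>R axis i 1"])
      (auto intro!: derivative_eq_intros simp: assms)
  then show ?thesis
    unfolding partial_def by (intro vector_derivative_at) (simp add: has_vector_derivative_def f'.scaleR)
qed

locale C1_function =
  fixes u :: "real^'n::finite \<Rightarrow> complex"
  assumes differentiable: "\<And>x. u differentiable at x"
    and continuous_partial: "\<And>i. continuous_on UNIV (partial i u)"
begin

lemma continuous: "continuous_on UNIV u"
  by (meson continuous_at_imp_continuous_on differentiable differentiable_imp_continuous_within)

lemma u_measurable [measurable]: "u \<in> borel_measurable borel"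
  by (rule borel_measurable_continuous_onI[OF continuous])

lemma continuous_grad: "continuous_on UNIV (grad u)"
  unfolding grad_def by (rule continuous_on_vec_lambda) (rule continuous_partial)

lemma grad_measurable [measurable]: "grad u \<in> borel_measurable borel"
  by (rule borel_measurable_continuous_onI[OF continuous_grad])

text \<open>The coordinate formula for the derivative along lines, which makes the fundamental theorem of
  calculus available in every direction.\<close>

lemma has_directional_derivative:
  "((\<lambda>t. u (x + t *\<^sub>R k)) has_vector_derivative (\<Sum>i\<in>UNIV. k $ i *\<^sub>R partial i u (x + t *\<^sub>R k))) (at t within S)"
proof -
  obtain u' where u': "(u has_derivative u') (at (x + t *\<^sub>R k))"
    using differentiable differentiable_def by blast
  then interpret u': bounded_linear u' by (rule has_derivative_bounded_linear)
  have p: "partial i u (x + t *\<^sub>R k) = u' (axis i 1)" for i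
    by (rule partial_eq_derivative[OF u'])
  have "u' k = u' (\<Sum>i\<in>UNIV. k $ i *\<^sub>R axis i 1)"
    by (simp add: basis_expansion scalar_mult_eq_scaleR[symmetric])
  then have k: "u' k = (\<Sum>i\<in>UNIV. k $ i *\<^sub>R partial i u (x + t *\<^sub>R k))"
    by (simp add: u'.sum u'.scaleR p)
  have "((\<lambda>t. u (x + t *\<^sub>R k)) has_derivative (\<lambda>h. u' (h *\<^sub>R k))) (at t within S)"
    by (rule has_derivative_compose[where g = u and f = "\<lambda>t. x + t *\<^sub>R k"])
      (auto intro!: derivative_eq_intros simp: u')
  then show ?thesis
    by (simp add: has_vector_derivative_def u'.scaleR k)
qed

lemma norm_directional_derivative_le:
  "norm (\<Sum>i\<in>UNIV. k $ i *\<^sub>R partial i u x) \<le> norm k * norm (grad u x)"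
proof -
  have "norm (\<Sum>i\<in>UNIV. k $ i *\<^sub>R partial i u x) \<le> (\<Sum>i\<in>UNIV. \<bar>k $ i\<bar> * \<bar>norm (partial i u x)\<bar>)"
    by (rule order_trans[OF norm_sum]) simp
  also have "\<dots> \<le> L2_set (\<lambda>i. k $ i) UNIV * L2_set (\<lambda>i. norm (partial i u x)) UNIV"
    by (rule L2_set_mult_ineq)
  also have "\<dots> = norm k * norm (grad u x)"
    by (simp add: norm_vec_def grad_def L2_set_def)
  finally show ?thesis .
qed

text \<open>The fundamental theorem of calculus on the segment from \<open>x\<close> to \<open>x + k\<close>, followed by the
  Cauchy-Schwarz inequality.\<close>

lemma increment_square_le:
  "ennreal ((norm (u (x + k) - u x))\<^sup>2)
    \<le> ennreal ((norm k)\<^sup>2) * (\<integral>\<^sup>+t\<in>{0..1}. ennreal ((norm (grad u (x + t *\<^sub>R k)))\<^sup>2) \<partial>lborel)"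
proof -
  let ?g = "\<lambda>t::real. norm (grad u (x + t *\<^sub>R k))"
  let ?d = "\<lambda>t::real. \<Sum>i\<in>UNIV. k $ i *\<^sub>R partial i u (x + t *\<^sub>R k)"
  have idem: "a * indicator {0..1} t * indicator {0..1} t = a * indicator {0..1} t" for a :: ennreal and t :: real
    by (simp add: indicator_def)
  have cont: "continuous_on {0..1} ?d"
    by (intro continuous_intros continuous_on_compose2[OF continuous_partial]) auto
  have "u (x + k) - u x = (LINT t|lborel. indicator {0..1} t *\<^sub>R ?d t)"
    by (subst integral_FTC_atLeastAtMost[OF _ has_directional_derivative cont]) auto
  then have "ennreal (norm (u (x + k) - u x)) \<le> (\<integral>\<^sup>+t. norm (indicator {0..1} t *\<^sub>R ?d t) \<partial>lborel)"
    using integral_norm_bound_ennreal borel_integrable_atLeastAtMost'[OF cont]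
    by (simp only: set_integrable_def)
  also have "\<dots> \<le> (\<integral>\<^sup>+t. ennreal (norm k) * (ennreal (?g t) * indicator {0..1} t) \<partial>lborel)"
    by (intro nn_integral_mono)
      (auto simp: indicator_def ennreal_mult[symmetric] norm_directional_derivative_le intro!: ennreal_leI)
  also have "\<dots> = ennreal (norm k) * (\<integral>\<^sup>+t. (ennreal (?g t) * indicator {0..1} t) * indicator {0..1} t \<partial>lborel)"
    unfolding idem by (rule nn_integral_cmult) measurable
  finally have "(ennreal (norm (u (x + k) - u x)))\<^sup>2
      \<le> (ennreal (norm k) * (\<integral>\<^sup>+t. (ennreal (?g t) * indicator {0..1} t) * indicator {0..1} t \<partial>lborel))\<^sup>2"
    by (rule power_mono) simp
  also have "\<dots> = (ennreal (norm k))\<^sup>2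
      * (\<integral>\<^sup>+t. (ennreal (?g t) * indicator {0..1} t) * indicator {0..1} t \<partial>lborel)\<^sup>2"
    by (simp add: power_mult_distrib)
  also have "\<dots> \<le> (ennreal (norm k))\<^sup>2 * ((\<integral>\<^sup>+t. (ennreal (?g t) * indicator {0..1} t)\<^sup>2 \<partial>lborel)
      * (\<integral>\<^sup>+t. (indicator {0..1} t)\<^sup>2 \<partial>(lborel :: real measure)))"
    by (intro mult_left_mono Cauchy_Schwarz_nn_integral) auto
  also have "(\<integral>\<^sup>+t. (indicator {0..1} t)\<^sup>2 \<partial>(lborel :: real measure)) = (\<integral>\<^sup>+t. indicator {0..1} t \<partial>(lborel :: real measure))"
    by (intro nn_integral_cong) (simp add: indicator_def)
  also have "\<dots> = 1" by simp
  also have "(\<integral>\<^sup>+t. (ennreal (?g t) * indicator {0..1} t)\<^sup>2 \<partial>lborel)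
      = (\<integral>\<^sup>+t\<in>{0..1}. ennreal ((?g t)\<^sup>2) \<partial>lborel)"
    by (intro nn_integral_cong) (auto simp: indicator_def ennreal_power)
  finally show ?thesis by (simp add: ennreal_power)
qed

lemma translation_L2:
  "(\<integral>\<^sup>+x. ennreal ((norm (u (x + k) - u x))\<^sup>2) \<partial>lborel)
    \<le> ennreal ((norm k)\<^sup>2) * (\<integral>\<^sup>+x. ennreal ((norm (grad u x))\<^sup>2) \<partial>lborel)"
proof -
  have "(\<integral>\<^sup>+x. ennreal ((norm (u (x + k) - u x))\<^sup>2) \<partial>lborel)
    \<le> (\<integral>\<^sup>+x. ennreal ((norm k)\<^sup>2) * (\<integral>\<^sup>+t\<in>{0..1}. ennreal ((norm (grad u (x + t *\<^sub>R k)))\<^sup>2) \<partial>lborel) \<partial>lborel)"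
    by (intro nn_integral_mono increment_square_le)
  also have "\<dots> = ennreal ((norm k)\<^sup>2)
      * (\<integral>\<^sup>+x. (\<integral>\<^sup>+t\<in>{0..1}. ennreal ((norm (grad u (x + t *\<^sub>R k)))\<^sup>2) \<partial>lborel) \<partial>lborel)"
    by (rule nn_integral_cmult) measurable
  also have "(\<integral>\<^sup>+x. (\<integral>\<^sup>+t\<in>{0..1}. ennreal ((norm (grad u (x + t *\<^sub>R k)))\<^sup>2) \<partial>lborel) \<partial>lborel)
      = (\<integral>\<^sup>+t. (\<integral>\<^sup>+x. ennreal ((norm (grad u (x + t *\<^sub>R k)))\<^sup>2) * indicator {0..1} t \<partial>lborel) \<partial>(lborel::real measure))"
    by (rule lborel_pair.Fubini') measurable
  also have "\<dots> = (\<integral>\<^sup>+t\<in>{0..1}. (\<integral>\<^sup>+x. ennreal ((norm (grad u x))\<^sup>2) \<partial>lborel) \<partial>(lborel::real measure))"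
    by (intro nn_integral_cong, subst nn_integral_multc)
      (auto simp: nn_integral_translate[where F = "\<lambda>x. ennreal ((norm (grad u x))\<^sup>2)"])
  also have "\<dots> = (\<integral>\<^sup>+x. ennreal ((norm (grad u x))\<^sup>2) \<partial>lborel)"
    by (subst nn_integral_cmult_indicator) auto
  finally show ?thesis .
qed

text \<open>All points of the cell of \<open>x\<close> have the form \<open>x + k\<close> with \<open>k\<close> in a fixed cube. Enlarging the
  domain of integration to that cube gives a bound that no longer refers to the grid.\<close>

lemma cell_mean_diff_square_le:
  assumes "0 < h"
  shows "ennreal ((norm (u x - cell_mean h u x))\<^sup>2)
    \<le> ennreal (1 / h ^ CARD('n)) * (\<integral>\<^sup>+k\<in>cbox (- h *\<^sub>R One) (h *\<^sub>R One). ennreal ((norm (u (x + k) - u x))\<^sup>2) \<partial>lborel)"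
proof -
  define R where "R = cell h (grid_index h x)"
  define m where "m = mean_on R u"
  define v where "v = h ^ CARD('n)"
  let ?K = "cbox (- h *\<^sub>R One) (h *\<^sub>R One) :: (real^'n) set"
  have v: "0 < v" using assms by (simp add: v_def)
  have R[measurable]: "R \<in> sets borel" "R \<in> lmeasurable" "measure lebesgue R = v"
    using assms cell_borel by (simp_all add: R_def v_def cell_lmeasurable measure_cell)
  have int: "(\<lambda>y. u y - u x) absolutely_integrable_on R"
    unfolding R_def by (intro continuous_integrable_cell assms continuous_intros continuous)
  have "ennreal (v * norm (m - u x)) \<le> (\<integral>\<^sup>+y. ennreal (norm (u y - u x)) * indicator R y \<partial>lborel)"
  proof -
    have "v * norm (m - u x) \<le> (LINT y:R|lebesgue. norm (u y - u x))"
      using norm_mean_on_diff_le[of R u "u x"] R v continuous_integrable_cell[OF continuous assms]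
      by (simp add: m_def R_def)
    then have "ennreal (v * norm (m - u x)) \<le> ennreal (LINT y:R|lebesgue. norm (u y - u x))"
      by (rule ennreal_leI)
    also have "\<dots> = (\<integral>\<^sup>+y. ennreal (indicator R y *\<^sub>R norm (u y - u x)) \<partial>lebesgue)"
      unfolding set_lebesgue_integral_def
      using set_integrable_norm[OF int] by (intro nn_integral_eq_integral[symmetric]) (auto simp: set_integrable_def)
    also have "\<dots> = (\<integral>\<^sup>+y. ennreal (norm (u y - u x)) * indicator R y \<partial>lborel)"
      unfolding nn_integral_completion by (intro nn_integral_cong) (simp split: split_indicator)
    finally show ?thesis .
  qed
  then have "(ennreal (v * norm (m - u x)))\<^sup>2 \<le> (\<integral>\<^sup>+y. ennreal (norm (u y - u x)) * indicator R y \<partial>lborel)\<^sup>2"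
    by (rule power_mono) simp
  also have "\<dots> = (\<integral>\<^sup>+y. (ennreal (norm (u y - u x)) * indicator R y) * indicator R y \<partial>lborel)\<^sup>2"
    by (intro arg_cong[where f = "\<lambda>a. a\<^sup>2"] nn_integral_cong) (simp add: indicator_def)
  also have "\<dots> \<le> (\<integral>\<^sup>+y. (ennreal (norm (u y - u x)) * indicator R y)\<^sup>2 \<partial>lborel) * (\<integral>\<^sup>+y. (indicator R y)\<^sup>2 \<partial>lborel)"
    by (rule Cauchy_Schwarz_nn_integral) measurable
  also have "(\<integral>\<^sup>+y. (indicator R y)\<^sup>2 \<partial>lborel) = (\<integral>\<^sup>+y. indicator R y \<partial>lborel)"
    by (intro nn_integral_cong) (simp add: indicator_def)
  also have "\<dots> = ennreal v"
    using emeasure_cell[OF assms, of "grid_index h x"] by (simp add: R_def v_def)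
  also have "(\<integral>\<^sup>+y. (ennreal (norm (u y - u x)) * indicator R y)\<^sup>2 \<partial>lborel)
      \<le> (\<integral>\<^sup>+y. ennreal ((norm (u y - u x))\<^sup>2) * indicator ?K (y - x) \<partial>lborel)"
  proof (rule nn_integral_mono)
    fix y
    have "y - x \<in> ?K" if "y \<in> R"
    proof -
      have "corner h (grid_index h x) $ i \<le> y $ i \<and> y $ i < corner h (grid_index h x) $ i + h
        \<and> corner h (grid_index h x) $ i \<le> x $ i \<and> x $ i < corner h (grid_index h x) $ i + h" for i
        using that in_own_cell[of x h] mem_cell_iff[OF assms] unfolding R_def by blast
      then have "- h \<le> y $ i - x $ i \<and> y $ i - x $ i \<le> h" for i
        by (smt (verit))
      then show ?thesis by (simp add: mem_box_cart)
    qed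
    then show "(ennreal (norm (u y - u x)) * indicator R y)\<^sup>2
        \<le> ennreal ((norm (u y - u x))\<^sup>2) * indicator ?K (y - x)"
      by (auto simp: indicator_def ennreal_power)
  qed
  also have "\<dots> = (\<integral>\<^sup>+k. ennreal ((norm (u (x + k) - u x))\<^sup>2) * indicator ?K k \<partial>lborel)"
    by (subst nn_integral_translate[where k = x, symmetric]) (auto simp: add.commute)
  finally have le: "(ennreal (v * norm (m - u x)))\<^sup>2
      \<le> (\<integral>\<^sup>+k. ennreal ((norm (u (x + k) - u x))\<^sup>2) * indicator ?K k \<partial>lborel) * ennreal v"
    by (simp add: mult_right_mono)
  have "ennreal ((norm (u x - cell_mean h u x))\<^sup>2) = ennreal (1 / v) * (ennreal (1 / v) * (ennreal (v * norm (m - u x)))\<^sup>2)"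
    using v by (simp add: cell_mean_def m_def R_def norm_minus_commute ennreal_power ennreal_mult[symmetric]
        power2_eq_square field_simps)
  also have "\<dots> \<le> ennreal (1 / v) * (ennreal (1 / v) *
      ((\<integral>\<^sup>+k. ennreal ((norm (u (x + k) - u x))\<^sup>2) * indicator ?K k \<partial>lborel) * ennreal v))"
    by (intro mult_left_mono le) auto
  also have "\<dots> = ennreal (1 / v) * (\<integral>\<^sup>+k. ennreal ((norm (u (x + k) - u x))\<^sup>2) * indicator ?K k \<partial>lborel)
      * (ennreal (1 / v) * ennreal v)"
    by (simp only: mult_ac)
  also have "ennreal (1 / v) * ennreal v = 1"
    using v by (simp add: ennreal_mult[symmetric])
  finally show ?thesis by (simp add: v_def)
qed

text \<open>Summed over all cells, the Poincare inequality follows from the translation estimate by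
  integration over the translation vector.\<close>

theorem Poincare_cells:
  fixes h :: real
  assumes "0 < h"
  shows "(\<integral>\<^sup>+x. ennreal ((norm (u x - cell_mean h u x))\<^sup>2) \<partial>lborel)
    \<le> ennreal (2 ^ CARD('n) * CARD('n) * h\<^sup>2) * (\<integral>\<^sup>+x. ennreal ((norm (grad u x))\<^sup>2) \<partial>lborel)"
proof -
  let ?K = "cbox (- h *\<^sub>R One) (h *\<^sub>R One) :: (real^'n) set"
  let ?W = "\<integral>\<^sup>+x. ennreal ((norm (grad u x))\<^sup>2) \<partial>lborel"
  have "(\<integral>\<^sup>+x. ennreal ((norm (u x - cell_mean h u x))\<^sup>2) \<partial>lborel)
      \<le> (\<integral>\<^sup>+x. ennreal (1 / h ^ CARD('n)) * (\<integral>\<^sup>+k\<in>?K. ennreal ((norm (u (x + k) - u x))\<^sup>2) \<partial>lborel) \<partial>lborel)"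
    by (intro nn_integral_mono cell_mean_diff_square_le assms)
  also have "\<dots> = ennreal (1 / h ^ CARD('n))
      * (\<integral>\<^sup>+x. (\<integral>\<^sup>+k\<in>?K. ennreal ((norm (u (x + k) - u x))\<^sup>2) \<partial>lborel) \<partial>lborel)"
    by (rule nn_integral_cmult) measurable
  also have "(\<integral>\<^sup>+x. (\<integral>\<^sup>+k\<in>?K. ennreal ((norm (u (x + k) - u x))\<^sup>2) \<partial>lborel) \<partial>lborel)
      = (\<integral>\<^sup>+k. (\<integral>\<^sup>+x. ennreal ((norm (u (x + k) - u x))\<^sup>2) * indicator ?K k \<partial>lborel) \<partial>lborel)"
    by (rule lborel_pair.Fubini') measurable
  also have "\<dots> \<le> (\<integral>\<^sup>+k. ennreal (CARD('n) * h\<^sup>2) * ?W * indicator ?K k \<partial>lborel)"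
  proof (rule nn_integral_mono)
    fix k :: "real^'n"
    have "(norm k)\<^sup>2 \<le> CARD('n) * h\<^sup>2" if "k \<in> ?K"
    proof -
      have "(norm k)\<^sup>2 = (\<Sum>i\<in>UNIV. (k $ i)\<^sup>2)"
        by (simp add: norm_vec_def L2_set_def sum_nonneg)
      also have "\<dots> \<le> (\<Sum>i\<in>(UNIV :: 'n set). h\<^sup>2)"
      proof (rule sum_mono)
        fix i
        have "\<bar>k $ i\<bar> \<le> \<bar>h\<bar>"
          using that by (simp add: mem_box_cart) (smt (verit))
        then show "(k $ i)\<^sup>2 \<le> h\<^sup>2" by (simp add: abs_le_square_iff)
      qed
      finally show ?thesis by simp
    qed
    then have "ennreal ((norm k)\<^sup>2) * indicator ?K k \<le> ennreal (CARD('n) * h\<^sup>2) * indicator ?K k"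
      by (auto simp: indicator_def intro!: ennreal_leI)
    then have "ennreal ((norm k)\<^sup>2) * indicator ?K k * ?W \<le> ennreal (CARD('n) * h\<^sup>2) * indicator ?K k * ?W"
      by (rule mult_right_mono) simp
    then have "ennreal ((norm k)\<^sup>2) * ?W * indicator ?K k \<le> ennreal (CARD('n) * h\<^sup>2) * ?W * indicator ?K k"
      by (simp only: mult_ac)
    moreover have "(\<integral>\<^sup>+x. ennreal ((norm (u (x + k) - u x))\<^sup>2) * indicator ?K k \<partial>lborel)
        \<le> ennreal ((norm k)\<^sup>2) * ?W * indicator ?K k"
      by (subst nn_integral_multc) (auto intro!: mult_right_mono translation_L2)
    ultimately show "(\<integral>\<^sup>+x. ennreal ((norm (u (x + k) - u x))\<^sup>2) * indicator ?K k \<partial>lborel)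
        \<le> ennreal (CARD('n) * h\<^sup>2) * ?W * indicator ?K k"
      by (rule order_trans[rotated])
  qed
  also have "\<dots> = ennreal (CARD('n) * h\<^sup>2) * ?W * ennreal ((2 * h) ^ CARD('n))"
  proof -
    have "cbox (- h *\<^sub>R One) (h *\<^sub>R One) = cube (- h *\<^sub>R One :: real^'n) (2 * h)"
    proof -
      have "- h *\<^sub>R One + (2 * h) *\<^sub>R One = (h *\<^sub>R One :: real^'n)"
        by (simp add: vec_eq_iff)
      then show ?thesis by (simp only: cube_def)
    qed
    then have "emeasure lborel ?K = ennreal ((2 * h) ^ CARD('n))"
      using emeasure_cube[of "2 * h" "- h *\<^sub>R One :: real^'n"] assms by simp
    then show ?thesis
      by (subst nn_integral_cmult_indicator) auto
  qed
  finally have "(\<integral>\<^sup>+x. ennreal ((norm (u x - cell_mean h u x))\<^sup>2) \<partial>lborel)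
      \<le> ennreal (1 / h ^ CARD('n)) * (ennreal (CARD('n) * h\<^sup>2) * ?W * ennreal ((2 * h) ^ CARD('n)))"
    by (simp add: mult_left_mono)
  also have "\<dots> = ennreal (1 / h ^ CARD('n)) * ennreal (CARD('n) * h\<^sup>2) * ennreal ((2 * h) ^ CARD('n)) * ?W"
    by (simp only: mult_ac)
  also have "ennreal (1 / h ^ CARD('n)) * ennreal (CARD('n) * h\<^sup>2) * ennreal ((2 * h) ^ CARD('n))
      = ennreal (2 ^ CARD('n) * CARD('n) * h\<^sup>2)"
    using assms by (simp add: ennreal_mult[symmetric] power_mult_distrib mult_ac)
  finally show ?thesis .
qed

lemma cell_mean_tendsto:
  assumes "0 < h"
  shows "(\<lambda>n. cell_mean (h / 2 ^ n) u x) \<longlonglongrightarrow> u x"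
proof (rule tendstoI)
  fix e :: real assume e: "0 < e"
  obtain d where d: "0 < d" "\<And>y. dist y x < d \<Longrightarrow> dist (u y) (u x) < e / 2"
    using continuous e unfolding continuous_on_iff by (metis UNIV_I half_gt_zero)
  have "(\<lambda>n. CARD('n) * (h / 2 ^ n)) \<longlonglongrightarrow> real CARD('n) * 0"
    by (intro tendsto_mult_left LIMSEQ_divide_realpow_zero) simp
  then have "\<forall>\<^sub>F n in sequentially. CARD('n) * (h / 2 ^ n) < d"
    using d by (auto dest: order_tendstoD)
  then show "\<forall>\<^sub>F n in sequentially. dist (cell_mean (h / 2 ^ n) u x) (u x) < e"
  proof eventually_elim
    fix n assume n: "CARD('n) * (h / 2 ^ n) < d"
    define r where "r = h / 2 ^ n"
    define R where "R = cell r (grid_index r x)"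
    have r: "0 < r" "CARD('n) * r < d" using assms n by (simp_all add: r_def)
    have near: "norm (u y - u x) \<le> e / 2" if "y \<in> R" for y
    proof -
      have "\<bar>y $ i - x $ i\<bar> \<le> r" for i
        using that in_own_cell[of x r] mem_cell_iff[OF r(1)] unfolding R_def by (smt (verit))
      then have "norm (y - x) \<le> CARD('n) * r"
        using norm_le_l1_cart[of "y - x"] sum_mono[of UNIV "\<lambda>i. \<bar>(y - x) $ i\<bar>" "\<lambda>_. r"] by simp
      then show ?thesis using d(2)[of y] r(2) by (simp add: dist_norm less_imp_le)
    qed
    have Rm: "R \<in> lmeasurable" "measure lebesgue R = r ^ CARD('n)"
      using r by (simp_all add: R_def cell_lmeasurable measure_cell)
    have "measure lebesgue R * norm (mean_on R u - u x) \<le> (LINT y:R|lebesgue. norm (u y - u x))"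
      using norm_mean_on_diff_le[of R u "u x"] Rm r continuous_integrable_cell[OF continuous r(1)]
      by (simp add: R_def)
    also have "\<dots> \<le> (LINT y:R|lebesgue. e / 2)"
      unfolding R_def
      by (intro set_integral_mono continuous_integrable_cell r continuous_intros continuous)
        (use near in \<open>simp add: R_def\<close>)
    also have "\<dots> = measure lebesgue R * (e / 2)"
      using absolutely_integrable_on_const[OF Rm(1), of "1::real"] Rm(1)
      by (simp add: set_lebesgue_integral_def set_integrable_def)
    finally have "norm (mean_on R u - u x) \<le> e / 2"
      using r by (simp add: Rm(2))
    then show "dist (cell_mean (h / 2 ^ n) u x) (u x) < e"
      using e by (simp add: dist_norm cell_mean_def R_def r_def)
  qed
qed

end

section \<open>Multiplication by the oscillation of a BMO function\<close>

text \<open>Repeated use of \<open>(a + b)\<^sup>2 \<le> 2 a\<^sup>2 + 2 b\<^sup>2\<close>. The weights grow geometrically, which is affordable for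
  terms whose squares decay faster.\<close>

lemma norm_sum_square_geometric:
  fixes v :: "nat \<Rightarrow> 'a::real_normed_vector"
  shows "(norm (\<Sum>n<N. v n))\<^sup>2 \<le> (\<Sum>n<N. 2 ^ Suc n * (norm (v n))\<^sup>2)"
proof (induction N arbitrary: v)
  case (Suc N)
  have "norm (\<Sum>n<Suc N. v n) \<le> norm (v 0) + norm (\<Sum>n<N. v (Suc n))"
    by (subst sum.lessThan_Suc_shift) (rule norm_triangle_ineq)
  then have "(norm (\<Sum>n<Suc N. v n))\<^sup>2 \<le> (norm (v 0) + norm (\<Sum>n<N. v (Suc n)))\<^sup>2"
    by (intro power_mono) auto
  also have "\<dots> \<le> 2 * (norm (v 0))\<^sup>2 + 2 * (norm (\<Sum>n<N. v (Suc n)))\<^sup>2"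
    by (rule square_sum_le)
  also have "\<dots> \<le> 2 * (norm (v 0))\<^sup>2 + 2 * (\<Sum>n<N. 2 ^ Suc n * (norm (v (Suc n)))\<^sup>2)"
    using Suc.IH[of "\<lambda>n. v (Suc n)"] by simp
  also have "\<dots> = (\<Sum>n<Suc N. 2 ^ Suc n * (norm (v n))\<^sup>2)"
    by (subst sum.lessThan_Suc_shift) (simp add: sum_distrib_left mult.assoc)
  finally show ?case .
qed simp

text \<open>The full series has sum 12.\<close>

lemma sum_squares_over_powers_le: "(\<Sum>n<N. (real n + 1)\<^sup>2 / 2 ^ n) \<le> 12"
proof -
  have "(\<Sum>n<N. (real n + 1)\<^sup>2 / 2 ^ n) = 12 - (2 * (real N)\<^sup>2 + 8 * real N + 12) / 2 ^ N"
  proof (induction N)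
    case (Suc N)
    have "(\<Sum>n<Suc N. (real n + 1)\<^sup>2 / 2 ^ n)
        = 12 - (2 * (real N)\<^sup>2 + 8 * real N + 12) / 2 ^ N + (real N + 1)\<^sup>2 / 2 ^ N"
      by (simp add: Suc.IH)
    also have "\<dots> = 12 - (2 * (real (Suc N))\<^sup>2 + 8 * real (Suc N) + 12) / 2 ^ Suc N"
      by (simp add: field_simps power2_eq_square)
    finally show ?case .
  qed simp
  then show ?thesis by simp
qed

context bounded_mean_oscillation begin

text \<open>Each halving of the mesh moves the mean by at most \<open>D M\<close>; this is the logarithmic growth of
  \<open>BMO\<close> functions.\<close>

lemma mean_drift:
  assumes "0 < h"
  shows "norm (cell_mean (h / 2 ^ n) f x - cell_mean h f x) \<le> n * (D * M)"
proof (induction n)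
  case (Suc n)
  define r where "r = h / 2 ^ Suc n"
  have r: "0 < r" "2 * r = h / 2 ^ n" using assms by (simp_all add: r_def)
  have "cell r (grid_index r x) \<subseteq> cell (2 * r) (grid_index (2 * r) x)"
    using cell_subset_parent[of r "grid_index r x"] by (simp add: grid_index_double)
  from mean_nested_cells[OF r(1) this]
  have "norm (cell_mean r f x - cell_mean (2 * r) f x) \<le> D * M"
    by (simp add: cell_mean_def)
  then have "norm (cell_mean r f x - cell_mean h f x) \<le> D * M + n * (D * M)"
    using Suc.IH norm_triangle_ineq[of "cell_mean r f x - cell_mean (2 * r) f x" "cell_mean (2 * r) f x - cell_mean h f x"]
    by (simp add: r(2))
  then show ?case by (simp add: r_def algebra_simps)
qed simp

definition weight_const :: real where
  "weight_const = 2 * (JN_const + D\<^sup>2) * M\<^sup>2"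

lemma weight_const_nonneg: "0 \<le> weight_const"
  by (simp add: weight_const_def)

text \<open>On a cell of mesh \<open>h / 2\<^sup>n\<close>, the mean square deviation from the mean of that cell is given by
  the John-Nirenberg inequality, and the distance from that mean to \<open>A\<close> by the drift.\<close>

lemma weight_on_small_cells:
  assumes "0 < h" "r = h / 2 ^ n"
  shows "(\<integral>\<^sup>+x\<in>cell r z. ennreal ((norm (f x - cell_mean h f x))\<^sup>2) \<partial>lebesgue)
    \<le> ennreal (weight_const * (real n + 1)\<^sup>2 * r ^ CARD('n))"
proof -
  have r: "0 < r" using assms by simp
  define c where "c = mean_on (cell r z) f"
  let ?a = "2 * (n * (D * M))\<^sup>2"
  have "(\<integral>\<^sup>+x\<in>cell r z. ennreal ((norm (f x - cell_mean h f x))\<^sup>2) \<partial>lebesgue)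
      \<le> (\<integral>\<^sup>+x. 2 * (ennreal ((norm (f x - c))\<^sup>2) * indicator (cell r z) x)
          + ennreal ?a * indicator (cell r z) x \<partial>lebesgue)"
  proof (rule nn_integral_mono)
    fix x
    have "ennreal ((norm (f x - cell_mean h f x))\<^sup>2) \<le> 2 * ennreal ((norm (f x - c))\<^sup>2) + ennreal ?a" if "x \<in> cell r z"
    proof -
      have "norm (f x - cell_mean h f x) \<le> norm (f x - c) + n * (D * M)"
        using mean_drift[OF assms(1), of n x] norm_triangle_ineq[of "f x - c" "c - cell_mean h f x"]
          cell_mean_eq[OF that, of f] assms(2) by (simp add: c_def)
      then have "(norm (f x - cell_mean h f x))\<^sup>2 \<le> (norm (f x - c) + n * (D * M))\<^sup>2"
        by (intro power_mono) auto
      also have "\<dots> \<le> 2 * (norm (f x - c))\<^sup>2 + ?a"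
        by (rule square_sum_le)
      finally show ?thesis
        by (subst (asm) ennreal_le_iff[symmetric]) (auto simp: ennreal_mult'' ennreal_plus)
    qed
    then show "ennreal ((norm (f x - cell_mean h f x))\<^sup>2) * indicator (cell r z) x
      \<le> 2 * (ennreal ((norm (f x - c))\<^sup>2) * indicator (cell r z) x) + ennreal ?a * indicator (cell r z) x"
      by (simp split: split_indicator)
  qed
  also have "\<dots> = 2 * (\<integral>\<^sup>+x\<in>cell r z. ennreal ((norm (f x - c))\<^sup>2) \<partial>lebesgue) + ennreal ?a * ennreal (r ^ CARD('n))"
    by (simp add: nn_integral_add nn_integral_cmult nn_integral_cmult_indicator emeasure_cell[OF r])
  also have "\<dots> \<le> 2 * ennreal (JN_const * M\<^sup>2 * r ^ CARD('n)) + ennreal ?a * ennreal (r ^ CARD('n))"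
    unfolding c_def by (intro add_right_mono mult_left_mono John_Nirenberg_square r) simp
  also have "\<dots> = ennreal (2 * (JN_const * M\<^sup>2 * r ^ CARD('n)) + ?a * r ^ CARD('n))"
    using r by (simp add: ennreal_mult'[symmetric] ennreal_plus[symmetric] flip: ennreal_numeral del: ennreal_plus)
  also have "\<dots> \<le> ennreal (weight_const * (real n + 1)\<^sup>2 * r ^ CARD('n))"
  proof (rule ennreal_leI)
    have "JN_const * M\<^sup>2 * 1 \<le> JN_const * M\<^sup>2 * (real n + 1)\<^sup>2"
      by (intro mult_left_mono) auto
    moreover have "(n * (D * M))\<^sup>2 \<le> D\<^sup>2 * M\<^sup>2 * (real n + 1)\<^sup>2"
    proof -
      have "(real n)\<^sup>2 \<le> (real n + 1)\<^sup>2" by (intro power_mono) auto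
      from mult_left_mono[OF this, of "D\<^sup>2 * M\<^sup>2"] show ?thesis
        by (simp add: power_mult_distrib mult_ac)
    qed
    ultimately have "2 * (JN_const * M\<^sup>2) + ?a \<le> weight_const * (real n + 1)\<^sup>2"
      unfolding weight_const_def by (simp only: distrib_right distrib_left mult.assoc)
    from mult_right_mono[OF this, of "r ^ CARD('n)"] r
    show "2 * (JN_const * M\<^sup>2 * r ^ CARD('n)) + ?a * r ^ CARD('n)
        \<le> weight_const * (real n + 1)\<^sup>2 * r ^ CARD('n)"
      by (simp only: distrib_right mult.assoc zero_le_power less_imp_le)
  qed
  finally show ?thesis .
qed

text \<open>Against functions constant on cells of mesh \<open>h / 2\<^sup>n\<close>, the weight \<open>\<bar>f - A\<bar>\<^sup>2\<close> is as good as a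
  constant of order \<open>M\<^sup>2 (n + 1)\<^sup>2\<close>.\<close>

lemma weighted_integral_le:
  assumes "0 < h" "r = h / 2 ^ n" and g: "\<And>x. g x = G (grid_index r x)"
  shows "(\<integral>\<^sup>+x. ennreal ((norm (f x - cell_mean h f x))\<^sup>2) * g x \<partial>lebesgue)
    \<le> ennreal (weight_const * (real n + 1)\<^sup>2) * (\<integral>\<^sup>+x. g x \<partial>lebesgue)"
proof -
  have r: "0 < r" using assms by simp
  have [measurable]: "g \<in> borel_measurable lebesgue"
  proof -
    have "g \<in> borel_measurable borel"
      unfolding g[abs_def] by (rule measurable_compose[OF grid_index_measurable]) simp
    then show ?thesis by (simp add: measurable_completion)
  qed
  have "(\<integral>\<^sup>+x. ennreal ((norm (f x - cell_mean h f x))\<^sup>2) * g x \<partial>lebesgue)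
      \<le> (\<integral>\<^sup>+x. ennreal (weight_const * (real n + 1)\<^sup>2) * g x \<partial>lebesgue)"
  proof (rule nn_integral_mono_cells[where h = r])
    fix z
    have const: "a * g x * indicator (cell r z) x = G z * (a * indicator (cell r z) x)" for a x
      by (simp add: g cell_def mult_ac split: split_indicator)
    have "(\<integral>\<^sup>+x\<in>cell r z. (ennreal ((norm (f x - cell_mean h f x))\<^sup>2) * g x) \<partial>lebesgue)
        = G z * (\<integral>\<^sup>+x\<in>cell r z. ennreal ((norm (f x - cell_mean h f x))\<^sup>2) \<partial>lebesgue)"
      unfolding const by (rule nn_integral_cmult) measurable
    also have "\<dots> \<le> G z * ennreal (weight_const * (real n + 1)\<^sup>2 * r ^ CARD('n))"
      by (intro mult_left_mono weight_on_small_cells assms) simp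
    also have "\<dots> = (\<integral>\<^sup>+x\<in>cell r z. (ennreal (weight_const * (real n + 1)\<^sup>2) * g x) \<partial>lebesgue)"
      unfolding const using weight_const_nonneg
      by (simp add: nn_integral_cmult nn_integral_cmult_indicator emeasure_cell[OF r] ennreal_mult')
    finally show "(\<integral>\<^sup>+x\<in>cell r z. (ennreal ((norm (f x - cell_mean h f x))\<^sup>2) * g x) \<partial>lebesgue)
        \<le> (\<integral>\<^sup>+x\<in>cell r z. (ennreal (weight_const * (real n + 1)\<^sup>2) * g x) \<partial>lebesgue)" .
  qed measurable
  also have "\<dots> = ennreal (weight_const * (real n + 1)\<^sup>2) * (\<integral>\<^sup>+x. g x \<partial>lebesgue)"
    by (rule nn_integral_cmult) measurable
  finally show ?thesis .
qed

text \<open>Write \<open>u\<close> as the telescoping sum of the differences \<open>v n\<close> of its cell means at mesh \<open>h / 2\<^sup>n\<close>. The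
  \<open>n\<close>-th difference is constant on cells of that mesh, where the weight counts \<open>(n + 1)\<^sup>2\<close>, and its
  squared \<open>L\<^sup>2\<close> norm is \<open>O(4\<^sup>-\<^sup>n)\<close>. With the geometric weights \<open>2\<^sup>n\<^sup>+\<^sup>1\<close> the sum is bounded by that of
  \<open>20 (n + 1)\<^sup>2 / 2\<^sup>n\<close>, which is at most 240.\<close>

theorem oscillation_multiplier:
  fixes h :: real
  assumes "C1_function u" "0 < h"
  shows "(\<integral>\<^sup>+x. ennreal ((norm (f x - cell_mean h f x))\<^sup>2) * ennreal ((norm (u x))\<^sup>2) \<partial>lebesgue)
    \<le> ennreal (240 * weight_const) * ((\<integral>\<^sup>+x. ennreal ((norm (u x))\<^sup>2) \<partial>lebesgue)
      + ennreal (2 ^ CARD('n) * CARD('n) * h\<^sup>2) * (\<integral>\<^sup>+x. ennreal ((norm (grad u x))\<^sup>2) \<partial>lebesgue))"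
    (is "?lhs \<le> ennreal (240 * weight_const) * ?H")
proof -
  interpret u: C1_function u by (rule assms(1))
  have [measurable]: "u \<in> borel_measurable lebesgue"
    using u.u_measurable by (simp add: measurable_completion)
  let ?X = "\<integral>\<^sup>+x. ennreal ((norm (u x))\<^sup>2) \<partial>lebesgue"
  let ?Y = "\<integral>\<^sup>+x. ennreal ((norm (grad u x))\<^sup>2) \<partial>lebesgue"
  define P where "P = 2 ^ CARD('n) * real CARD('n)"
  have P: "0 \<le> P" by (simp add: P_def)
  let ?E = "\<lambda>n. cell_mean (h / 2 ^ n) u"
  let ?V = "\<lambda>x. ennreal ((norm (f x - cell_mean h f x))\<^sup>2)"
  define v where "v n = (case n of 0 \<Rightarrow> ?E 0 | Suc m \<Rightarrow> (\<lambda>x. ?E (Suc m) x - ?E m x))" for n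
  have [measurable]: "v n \<in> borel_measurable lebesgue" for n
    unfolding v_def by (cases n) auto
  have telescope: "?E N x = (\<Sum>n<Suc N. v n x)" for N x
    by (induction N) (simp_all add: v_def)
  have Poincare: "(\<integral>\<^sup>+x. ennreal ((norm (u x - ?E n x))\<^sup>2) \<partial>lebesgue) \<le> ennreal (P * (h / 2 ^ n)\<^sup>2) * ?Y" for n
    using u.Poincare_cells[of "h / 2 ^ n"] assms(2) unfolding nn_integral_completion P_def by simp
  \<comment> \<open>The factor 10 is \<open>2 * 4 + 2\<close>: the mesh \<open>h / 2\<^sup>n\<^sup>-\<^sup>1\<close> contributes four times as much as \<open>h / 2\<^sup>n\<close>.\<close>
  have v_L2: "(\<integral>\<^sup>+x. ennreal ((norm (v n x))\<^sup>2) \<partial>lebesgue) \<le> ennreal (10 / 4 ^ n) * ?H" for n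
  proof (cases n)
    case 0
    have "ennreal ((norm (v n x))\<^sup>2) \<le> 2 * ennreal ((norm (u x))\<^sup>2) + 2 * ennreal ((norm (u x - ?E 0 x))\<^sup>2)" for x
    proof -
      have "norm (v n x) \<le> norm (u x) + norm (u x - ?E 0 x)"
        using norm_triangle_ineq4[of "u x" "u x - ?E 0 x"] by (simp add: v_def 0)
      then have "(norm (v n x))\<^sup>2 \<le> (norm (u x) + norm (u x - ?E 0 x))\<^sup>2"
        by (intro power_mono) auto
      also have "\<dots> \<le> 2 * (norm (u x))\<^sup>2 + 2 * (norm (u x - ?E 0 x))\<^sup>2"
        by (rule square_sum_le)
      finally show ?thesis
        by (subst (asm) ennreal_le_iff[symmetric]) (auto simp: ennreal_mult'' ennreal_plus)
    qed
    then have "(\<integral>\<^sup>+x. ennreal ((norm (v n x))\<^sup>2) \<partial>lebesgue)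
        \<le> (\<integral>\<^sup>+x. 2 * ennreal ((norm (u x))\<^sup>2) + 2 * ennreal ((norm (u x - ?E 0 x))\<^sup>2) \<partial>lebesgue)"
      by (intro nn_integral_mono) auto
    also have "\<dots> = 2 * ?X + 2 * (\<integral>\<^sup>+x. ennreal ((norm (u x - ?E 0 x))\<^sup>2) \<partial>lebesgue)"
      by (simp add: nn_integral_add nn_integral_cmult)
    also have "\<dots> \<le> 2 * ?X + 2 * (ennreal (P * h\<^sup>2) * ?Y)"
      using Poincare[of 0] by (intro add_left_mono mult_left_mono) auto
    also have "\<dots> = ennreal 2 * ?H"
      by (simp add: distrib_left P_def)
    also have "\<dots> \<le> ennreal (10 / 4 ^ n) * ?H"
      by (intro mult_right_mono ennreal_leI) (auto simp: 0)
    finally show ?thesis .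
  next
    case (Suc m)
    have "ennreal ((norm (v n x))\<^sup>2) \<le> 2 * ennreal ((norm (u x - ?E m x))\<^sup>2) + 2 * ennreal ((norm (u x - ?E n x))\<^sup>2)" for x
    proof -
      have "norm (v n x) \<le> norm (u x - ?E m x) + norm (u x - ?E n x)"
        using norm_triangle_ineq4[of "u x - ?E m x" "u x - ?E n x"] by (simp add: v_def Suc)
      then have "(norm (v n x))\<^sup>2 \<le> (norm (u x - ?E m x) + norm (u x - ?E n x))\<^sup>2"
        by (intro power_mono) auto
      also have "\<dots> \<le> 2 * (norm (u x - ?E m x))\<^sup>2 + 2 * (norm (u x - ?E n x))\<^sup>2"
        by (rule square_sum_le)
      finally show ?thesis
        by (subst (asm) ennreal_le_iff[symmetric]) (auto simp: ennreal_mult'' ennreal_plus)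
    qed
    then have "(\<integral>\<^sup>+x. ennreal ((norm (v n x))\<^sup>2) \<partial>lebesgue)
        \<le> (\<integral>\<^sup>+x. 2 * ennreal ((norm (u x - ?E m x))\<^sup>2) + 2 * ennreal ((norm (u x - ?E n x))\<^sup>2) \<partial>lebesgue)"
      by (intro nn_integral_mono) auto
    also have "\<dots> = 2 * (\<integral>\<^sup>+x. ennreal ((norm (u x - ?E m x))\<^sup>2) \<partial>lebesgue)
        + 2 * (\<integral>\<^sup>+x. ennreal ((norm (u x - ?E n x))\<^sup>2) \<partial>lebesgue)"
      by (simp add: nn_integral_add nn_integral_cmult)
    also have "\<dots> \<le> 2 * (ennreal (P * (h / 2 ^ m)\<^sup>2) * ?Y) + 2 * (ennreal (P * (h / 2 ^ n)\<^sup>2) * ?Y)"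
      by (intro add_mono mult_left_mono Poincare) auto
    also have "\<dots> = (2 * ennreal (P * (h / 2 ^ m)\<^sup>2) + 2 * ennreal (P * (h / 2 ^ n)\<^sup>2)) * ?Y"
      by (simp add: distrib_right mult.assoc)
    also have "2 * ennreal (P * (h / 2 ^ m)\<^sup>2) + 2 * ennreal (P * (h / 2 ^ n)\<^sup>2) = ennreal (10 / 4 ^ n * (P * h\<^sup>2))"
    proof -
      have pow: "(2 ^ m)\<^sup>2 = (4 :: real) ^ m"
        by (simp add: power2_eq_square flip: power_mult_distrib)
      have "2 * (P * (h / 2 ^ m)\<^sup>2) + 2 * (P * (h / 2 ^ n)\<^sup>2) = 10 / 4 ^ n * (P * h\<^sup>2)"
        by (simp add: Suc power_divide power_mult_distrib pow field_simps)
      then show ?thesis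
        using P by (simp add: ennreal_mult'[symmetric] ennreal_plus[symmetric] flip: ennreal_numeral del: ennreal_plus)
    qed
    also have "\<dots> * ?Y = ennreal (10 / 4 ^ n) * (ennreal (P * h\<^sup>2) * ?Y)"
      using P by (subst ennreal_mult) (simp_all add: mult.assoc)
    also have "\<dots> \<le> ennreal (10 / 4 ^ n) * ?H"
      by (intro mult_left_mono) (auto simp: P_def)
    finally show ?thesis .
  qed
  have Vv: "(\<integral>\<^sup>+x. ?V x * ennreal ((norm (v n x))\<^sup>2) \<partial>lebesgue)
      \<le> ennreal (weight_const * (real n + 1)\<^sup>2) * (ennreal (10 / 4 ^ n) * ?H)" for n
  proof -
    define r where "r = h / 2 ^ n"
    have "\<exists>G. \<forall>x. ennreal ((norm (v n x))\<^sup>2) = G (grid_index r x)"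
    proof (cases n)
      case 0
      then show ?thesis
        by (intro exI[of _ "\<lambda>z. ennreal ((norm (mean_on (cell r z) u))\<^sup>2)"]) (simp add: v_def cell_mean_def r_def)
    next
      case (Suc m)
      then have "2 * r = h / 2 ^ m" by (simp add: r_def)
      then show ?thesis using Suc
        by (intro exI[of _ "\<lambda>z. ennreal ((norm (mean_on (cell r z) u - mean_on (cell (2 * r) (\<chi> i. z $ i div 2)) u))\<^sup>2)"])
          (simp add: v_def cell_mean_def r_def flip: grid_index_double)
    qed
    then obtain G where "\<And>x. ennreal ((norm (v n x))\<^sup>2) = G (grid_index r x)" by blast
    from weighted_integral_le[where g = "\<lambda>x. ennreal ((norm (v n x))\<^sup>2)", OF assms(2) r_def this]
    show ?thesis
      by (rule order_trans) (intro mult_left_mono v_L2; simp)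
  qed
  have VE: "(\<integral>\<^sup>+x. ?V x * ennreal ((norm (?E N x))\<^sup>2) \<partial>lebesgue) \<le> ennreal (240 * weight_const) * ?H" for N
  proof -
    have "?V x * ennreal ((norm (?E N x))\<^sup>2)
        \<le> (\<Sum>n<Suc N. ennreal (2 ^ Suc n) * (?V x * ennreal ((norm (v n x))\<^sup>2)))" for x
    proof -
      have "ennreal ((norm (?E N x))\<^sup>2) \<le> ennreal (\<Sum>n<Suc N. 2 ^ Suc n * (norm (v n x))\<^sup>2)"
        unfolding telescope by (rule ennreal_leI[OF norm_sum_square_geometric])
      also have "\<dots> = (\<Sum>n<Suc N. ennreal (2 ^ Suc n * (norm (v n x))\<^sup>2))"
        by (rule sum_ennreal[symmetric]) simp
      also have "\<dots> = (\<Sum>n<Suc N. ennreal (2 ^ Suc n) * ennreal ((norm (v n x))\<^sup>2))"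
        by (intro sum.cong refl ennreal_mult) auto
      finally have "?V x * ennreal ((norm (?E N x))\<^sup>2)
          \<le> ?V x * (\<Sum>n<Suc N. ennreal (2 ^ Suc n) * ennreal ((norm (v n x))\<^sup>2))"
        by (rule mult_left_mono) simp
      also have "\<dots> = (\<Sum>n<Suc N. ennreal (2 ^ Suc n) * (?V x * ennreal ((norm (v n x))\<^sup>2)))"
        by (simp only: sum_distrib_left mult.left_commute)
      finally show ?thesis .
    qed
    then have "(\<integral>\<^sup>+x. ?V x * ennreal ((norm (?E N x))\<^sup>2) \<partial>lebesgue)
        \<le> (\<integral>\<^sup>+x. (\<Sum>n<Suc N. ennreal (2 ^ Suc n) * (?V x * ennreal ((norm (v n x))\<^sup>2))) \<partial>lebesgue)"
      by (intro nn_integral_mono)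
    also have "\<dots> = (\<Sum>n<Suc N. ennreal (2 ^ Suc n) * (\<integral>\<^sup>+x. ?V x * ennreal ((norm (v n x))\<^sup>2) \<partial>lebesgue))"
      by (subst nn_integral_sum, measurable) (intro sum.cong refl nn_integral_cmult, measurable)
    also have "\<dots> \<le> (\<Sum>n<Suc N. ennreal (2 ^ Suc n) * (ennreal (weight_const * (real n + 1)\<^sup>2) * (ennreal (10 / 4 ^ n) * ?H)))"
      by (intro sum_mono mult_left_mono Vv) simp
    also have "\<dots> = (\<Sum>n<Suc N. ennreal (20 * weight_const * ((real n + 1)\<^sup>2 / 2 ^ n))) * ?H"
    proof -
      have "ennreal (2 ^ Suc n) * (ennreal (weight_const * (real n + 1)\<^sup>2) * (ennreal (10 / 4 ^ n) * ?H))
          = ennreal (20 * weight_const * ((real n + 1)\<^sup>2 / 2 ^ n)) * ?H" for n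
      proof -
        have pow: "(4 :: real) ^ n = 2 ^ n * 2 ^ n"
          by (simp flip: power_mult_distrib)
        have "2 ^ Suc n * (weight_const * (real n + 1)\<^sup>2) * (10 / 4 ^ n)
            = 20 * weight_const * ((real n + 1)\<^sup>2 / 2 ^ n)"
          by (simp add: pow field_simps)
        then show ?thesis
          using weight_const_nonneg
          by (simp only: mult.assoc[symmetric] ennreal_mult[symmetric] zero_le_power zero_le_numeral
              zero_le_power2 mult_nonneg_nonneg divide_nonneg_nonneg)
      qed
      then show ?thesis by (simp only: sum_distrib_right)
    qed
    also have "(\<Sum>n<Suc N. ennreal (20 * weight_const * ((real n + 1)\<^sup>2 / 2 ^ n)))
        = ennreal (20 * weight_const * (\<Sum>n<Suc N. (real n + 1)\<^sup>2 / 2 ^ n))"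
      using weight_const_nonneg by (subst sum_ennreal) (simp_all only: sum_distrib_left, simp)
    also have "\<dots> * ?H \<le> ennreal (20 * weight_const * 12) * ?H"
      using weight_const_nonneg sum_squares_over_powers_le[of "Suc N"]
      by (intro mult_right_mono ennreal_leI mult_left_mono) auto
    finally show ?thesis by (simp add: mult.commute)
  qed
  have "?lhs \<le> (\<integral>\<^sup>+x. liminf (\<lambda>N. ?V x * ennreal ((norm (?E N x))\<^sup>2)) \<partial>lebesgue)"
  proof (rule nn_integral_mono)
    fix x
    have "(\<lambda>N. ennreal ((norm (f x - cell_mean h f x))\<^sup>2 * (norm (?E N x))\<^sup>2))
        \<longlonglongrightarrow> ennreal ((norm (f x - cell_mean h f x))\<^sup>2 * (norm (u x))\<^sup>2)"
      by (intro tendsto_ennrealI tendsto_intros u.cell_mean_tendsto assms(2))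
    then have "(\<lambda>N. ?V x * ennreal ((norm (?E N x))\<^sup>2)) \<longlonglongrightarrow> ?V x * ennreal ((norm (u x))\<^sup>2)"
      by (simp add: ennreal_mult)
    then show "?V x * ennreal ((norm (u x))\<^sup>2) \<le> liminf (\<lambda>N. ?V x * ennreal ((norm (?E N x))\<^sup>2))"
      by (simp add: lim_imp_Liminf)
  qed
  also have "\<dots> \<le> liminf (\<lambda>N. \<integral>\<^sup>+x. ?V x * ennreal ((norm (?E N x))\<^sup>2) \<partial>lebesgue)"
    by (rule nn_integral_liminf) measurable
  also have "\<dots> \<le> liminf (\<lambda>N :: nat. ennreal (240 * weight_const) * ?H)"
    by (intro Liminf_mono always_eventually allI VE)
  finally show ?thesis by (simp add: Liminf_const)
qed

end

section \<open>Pairing cell means with a derivative\<close>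

text \<open>The integrand is dominated by a series of multiples of indicators of cubes of side \<open>2 (j + 1)\<close>
  centred at the origin; it is integrable since \<open>(j + 1)\<^sup>-\<^sup>2\<close> is summable.\<close>

lemma nn_integral_decay_finite:
  "(\<integral>\<^sup>+x. ennreal (1 / (1 + norm (x :: real^'n::finite)) ^ (CARD('n) + 2)) \<partial>lborel) < \<infinity>"
proof -
  let ?m = "CARD('n) + 2"
  define Q :: "nat \<Rightarrow> (real^'n) set" where "Q j = cube (- real (Suc j) *\<^sub>R One) (2 * real (Suc j))" for j
  have [measurable]: "Q j \<in> sets borel" for j by (simp add: Q_def cube_def)
  have "ennreal (1 / (1 + norm x) ^ ?m) \<le> (\<Sum>j. ennreal (1 / real (Suc j) ^ ?m) * indicator (Q j) x)" for x
  proof -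
    define j where "j = nat \<lfloor>norm x\<rfloor>"
    have j: "real j \<le> norm x" "norm x < real j + 1" by (simp_all add: j_def)
    have "\<bar>x $ i\<bar> \<le> real (Suc j)" for i
      using component_le_norm_cart[of x i] j by simp
    then have x: "x \<in> Q j"
      by (simp add: Q_def mem_cube abs_le_iff) (smt (verit))
    have "1 / (1 + norm x) ^ ?m \<le> 1 / real (Suc j) ^ ?m"
      using j by (intro divide_left_mono power_mono mult_pos_pos zero_less_power) auto
    then have "ennreal (1 / (1 + norm x) ^ ?m) \<le> ennreal (1 / real (Suc j) ^ ?m) * indicator (Q j) x"
      using x by (simp add: ennreal_leI)
    also have "\<dots> \<le> (\<Sum>j. ennreal (1 / real (Suc j) ^ ?m) * indicator (Q j) x)"
      using sum_le_suminf[OF summableI, of "{j}" "\<lambda>j. ennreal (1 / real (Suc j) ^ ?m) * indicator (Q j) x"]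
      by (simp only: finite.intros sum.insert sum.empty empty_iff not_False_eq_True add_0_right simp_thms zero_le)
    finally show ?thesis .
  qed
  then have "(\<integral>\<^sup>+x. ennreal (1 / (1 + norm (x :: real^'n)) ^ ?m) \<partial>lborel)
      \<le> (\<integral>\<^sup>+x. (\<Sum>j. ennreal (1 / real (Suc j) ^ ?m) * indicator (Q j) x) \<partial>lborel)"
    by (intro nn_integral_mono)
  also have "\<dots> = (\<Sum>j. \<integral>\<^sup>+x. ennreal (1 / real (Suc j) ^ ?m) * indicator (Q j) x \<partial>lborel)"
    by (rule nn_integral_suminf) measurable
  also have "\<dots> = (\<Sum>j. ennreal (2 ^ CARD('n) * (1 / real (Suc j) ^ 2)))"
  proof (rule arg_cong[where f = suminf], rule ext)
    fix j
    have "emeasure lborel (Q j) = ennreal ((2 * real (Suc j)) ^ CARD('n))"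
      unfolding Q_def by (rule emeasure_cube) simp
    then have "(\<integral>\<^sup>+x. ennreal (1 / real (Suc j) ^ ?m) * indicator (Q j) x \<partial>lborel)
        = ennreal (1 / real (Suc j) ^ ?m) * ennreal ((2 * real (Suc j)) ^ CARD('n))"
      by (simp add: nn_integral_cmult_indicator del: of_nat_Suc)
    also have "\<dots> = ennreal (2 ^ CARD('n) * (1 / real (Suc j) ^ 2))"
      by (simp add: ennreal_mult[symmetric] power_mult_distrib power_add power2_eq_square field_simps del: of_nat_Suc)
    finally show "(\<integral>\<^sup>+x. ennreal (1 / real (Suc j) ^ ?m) * indicator (Q j) x \<partial>lborel)
        = ennreal (2 ^ CARD('n) * (1 / real (Suc j) ^ 2))" .
  qed
  also have "\<dots> < \<infinity>"
  proof -
    have "summable (\<lambda>j. 1 / real (Suc j) ^ 2)"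
      using inverse_power_summable[of 2, where 'a = real] summable_Suc_iff[of "\<lambda>j. 1 / real j ^ 2"]
      by (simp add: inverse_eq_divide)
    then have "summable (\<lambda>j. 2 ^ CARD('n) * (1 / real (Suc j) ^ 2))"
      by (rule summable_mult)
    then show ?thesis
      by (simp add: suminf_ennreal2 less_top[symmetric] del: of_nat_Suc)
  qed
  finally show ?thesis .
qed

lemma integral_translate:
  fixes F :: "'a::euclidean_space \<Rightarrow> 'b::{banach, second_countable_topology}"
  assumes [measurable]: "F \<in> borel_measurable borel"
  shows "(LINT x|lborel. F (x + k)) = (LINT x|lborel. F x)"
proof -
  have "(LINT x|lborel. F x) = (LINT x|distr lborel borel ((+) k). F x)"
    by (simp add: lborel_distr_plus)
  also have "\<dots> = (LINT x|lborel. F (k + x))"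
    by (subst integral_distr) auto
  finally show ?thesis by (simp add: add.commute)
qed

lemma integrable_decay:
  fixes F :: "real^'n::finite \<Rightarrow> 'b::{banach, second_countable_topology}"
  assumes [measurable]: "F \<in> borel_measurable borel"
    and bound: "\<And>x. norm (F x) \<le> C / (1 + norm x) ^ (CARD('n) + 2)"
  shows "integrable lborel F"
proof (rule integrableI_bounded)
  have C: "0 \<le> C" using bound[of 0] norm_ge_zero[of "F 0"] by (simp del: norm_ge_zero)
  have "(\<integral>\<^sup>+x. ennreal (norm (F x)) \<partial>lborel)
      \<le> (\<integral>\<^sup>+x. ennreal C * ennreal (1 / (1 + norm (x :: real^'n)) ^ (CARD('n) + 2)) \<partial>lborel)"
    using bound C by (intro nn_integral_mono) (simp add: ennreal_mult[symmetric] ennreal_leI)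
  also have "\<dots> = ennreal C * (\<integral>\<^sup>+x. ennreal (1 / (1 + norm (x :: real^'n)) ^ (CARD('n) + 2)) \<partial>lborel)"
    by (rule nn_integral_cmult) measurable
  also have "\<dots> < \<infinity>"
    using nn_integral_decay_finite[where 'n = 'n] by (simp add: ennreal_mult_less_top)
  finally show "(\<integral>\<^sup>+x. ennreal (norm (F x)) \<partial>lborel) < \<infinity>" .
qed simp

context bounded_mean_oscillation begin

text \<open>The cell of \<open>x\<close> and a fixed cube lie in a common cube of side \<open>O(1 + \<bar>x\<bar>)\<close>. The resulting
  polynomial bound is far from the true logarithmic growth but suffices against rapidly decreasing
  functions.\<close>

lemma cell_mean_growth:
  assumes "0 < h"
  shows "\<exists>K\<ge>0. \<forall>x. norm (cell_mean h f x) \<le> K * (1 + norm x) ^ CARD('n)"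
proof -
  let ?d = "CARD('n)"
  define m0 where "m0 = mean_on (cube (- h *\<^sub>R One) (2 * h)) f"
  define K where "K = norm m0 + 2 * M * (2 * (1 + h)) ^ ?d / h ^ ?d"
  have K: "0 \<le> K" using M_pos assms by (simp add: K_def)
  have "norm (cell_mean h f x) \<le> K * (1 + norm x) ^ ?d" for x
  proof -
    define R where "R = norm x + h"
    define Q where "Q = cube (- R *\<^sub>R One :: real^'n) (2 * R)"
    have R: "0 < 2 * R" "R \<le> (1 + h) * (1 + norm x)" using assms
      by (simp_all add: R_def algebra_simps add_pos_nonneg add_nonneg_pos)
    have sub1: "cell h (grid_index h x) \<subseteq> Q"
    proof
      fix y assume y: "y \<in> cell h (grid_index h x)"
      have "- R \<le> y $ i \<and> y $ i \<le> R" for i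
        using y in_own_cell[of x h] mem_cell_iff[OF assms] component_le_norm_cart[of x i]
        unfolding R_def by (smt (verit))
      then show "y \<in> Q" by (simp add: Q_def mem_cube)
    qed
    have sub2: "cube (- h *\<^sub>R One) (2 * h) \<subseteq> Q"
    proof
      fix y :: "real^'n" assume "y \<in> cube (- h *\<^sub>R One) (2 * h)"
      then have "- h \<le> y $ i" "y $ i \<le> h" for i by (auto simp: mem_cube)
      then have "- R \<le> y $ i" "y $ i \<le> R" for i
        unfolding R_def by (smt (verit) norm_ge_zero)+
      then show "y \<in> Q" by (simp add: Q_def mem_cube)
    qed
    have near: "norm (mean_on S f - mean_on Q f) \<le> M * (2 * R) ^ ?d / h ^ ?d"
      if "S \<subseteq> Q" "S \<in> sets lebesgue" "h ^ ?d \<le> measure lebesgue S" for S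
    proof -
      have pos: "0 < h ^ ?d" using assms by simp
      have "norm (mean_on S f - mean_on Q f) \<le> M * (2 * R) ^ ?d / measure lebesgue S"
        unfolding Q_def using that(1) by (intro mean_subset_diff R(1) that(2) less_le_trans[OF pos that(3)]) (simp add: Q_def)
      also have "\<dots> \<le> M * (2 * R) ^ ?d / h ^ ?d"
        using that pos M_pos R(1) by (intro divide_left_mono mult_pos_pos) auto
      finally show ?thesis .
    qed
    have "norm (cell_mean h f x - mean_on Q f) \<le> M * (2 * R) ^ ?d / h ^ ?d"
      unfolding cell_mean_def using assms by (intro near sub1) (simp_all add: measure_cell)
    moreover have "norm (m0 - mean_on Q f) \<le> M * (2 * R) ^ ?d / h ^ ?d"
    proof -
      have "h ^ ?d \<le> measure lebesgue (cube (- h *\<^sub>R One :: real^'n) (2 * h))"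
        using assms by (subst content_cube) (auto intro: power_mono)
      then show ?thesis unfolding m0_def by (intro near sub2) simp_all
    qed
    ultimately have "norm (cell_mean h f x) \<le> norm m0 + 2 * (M * (2 * R) ^ ?d / h ^ ?d)"
      by (smt (verit) norm_triangle_ineq2 norm_minus_commute norm_triangle_ineq)
    also have "\<dots> \<le> norm m0 * (1 + norm x) ^ ?d + 2 * (M * ((2 * (1 + h)) ^ ?d * (1 + norm x) ^ ?d) / h ^ ?d)"
    proof (intro add_mono mult_left_mono divide_right_mono)
      show "norm m0 \<le> norm m0 * (1 + norm x) ^ ?d"
        using mult_left_mono[of 1 "(1 + norm x) ^ ?d" "norm m0"] by simp
      have "(2 * R) ^ ?d \<le> (2 * (1 + h) * (1 + norm x)) ^ ?d"
        using R by (intro power_mono) (simp_all add: algebra_simps)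
      then show "(2 * R) ^ ?d \<le> (2 * (1 + h)) ^ ?d * (1 + norm x) ^ ?d"
        by (simp add: power_mult_distrib)
    qed (use M_pos assms in auto)
    also have "\<dots> = K * (1 + norm x) ^ ?d"
      by (simp add: K_def algebra_simps)
    finally show ?thesis .
  qed
  with K show ?thesis by blast
qed

lemma cell_mean_shift:
  assumes "0 < h" "0 \<le> s" "s \<le> h"
  shows "norm (cell_mean h f (y + s *\<^sub>R axis i 1) - cell_mean h f y) \<le> 2 * (D * M)"
  unfolding cell_mean_def mean_on_cell[OF assms(1)]
proof (rule mean_neighbour_cubes[OF assms(1)])
  fix j
  let ?a = "\<lambda>x :: real^'n. grid_index h x $ j"
  have "?a y \<le> ?a (y + s *\<^sub>R axis i 1)" "?a (y + s *\<^sub>R axis i 1) \<le> ?a y + 1"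
  proof -
    have "y $ j / h \<le> (y + s *\<^sub>R axis i 1) $ j / h" "(y + s *\<^sub>R axis i 1) $ j / h \<le> y $ j / h + 1"
      using assms by (auto simp: axis_def field_simps)
    then show "?a y \<le> ?a (y + s *\<^sub>R axis i 1)" "?a (y + s *\<^sub>R axis i 1) \<le> ?a y + 1"
      unfolding grid_index_def by (simp_all add: floor_mono) linarith
  qed
  then have "\<bar>real_of_int (?a (y + s *\<^sub>R axis i 1)) - real_of_int (?a y)\<bar> \<le> 1" by linarith
  then have "h * \<bar>real_of_int (?a (y + s *\<^sub>R axis i 1)) - real_of_int (?a y)\<bar> \<le> h * 1"
    using assms(1) by (intro mult_left_mono) auto
  then show "\<bar>corner h (grid_index h (y + s *\<^sub>R axis i 1)) $ j - corner h (grid_index h y) $ j\<bar> \<le> h"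
    using assms(1) by (simp add: corner_def abs_mult flip: right_diff_distrib)
qed

text \<open>Uniformity in the shift \<open>s\<close> provides the integrable majorant for Fubini's theorem.\<close>

lemma cell_mean_shifted_decay:
  fixes p :: "real^'n \<Rightarrow> complex"
  assumes "0 < h" and [measurable]: "p \<in> borel_measurable borel"
    and decay: "\<And>x. norm (p x) \<le> C / (1 + norm x) ^ (2 * CARD('n) + 2)"
  shows "\<exists>B. \<forall>s\<in>{0..h}. \<forall>y. norm (cell_mean h f y * p (y - s *\<^sub>R axis i 1)) \<le> B / (1 + norm y) ^ (CARD('n) + 2)"
proof -
  let ?d = "CARD('n)"
  obtain K where K: "0 \<le> K" "\<And>x. norm (cell_mean h f x) \<le> K * (1 + norm x) ^ ?d"
    using cell_mean_growth[OF assms(1)] by blast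
  have C: "0 \<le> C" using order_trans[OF norm_ge_zero decay[of 0]] by simp
  show ?thesis
  proof (intro exI ballI allI)
    fix s :: real and y :: "real^'n" assume s: "s \<in> {0..h}"
    let ?z = "y - s *\<^sub>R (axis i 1 :: real^'n)"
    have "norm y \<le> norm ?z + s"
      using norm_triangle_ineq[of ?z "s *\<^sub>R axis i 1 :: real^'n"] s by (simp add: norm_axis_1)
    then have "1 + norm y \<le> 1 + norm ?z + h" using s by simp
    also have "\<dots> \<le> (1 + h) * (1 + norm ?z)" using assms(1) by (simp add: algebra_simps)
    finally have "(1 + norm y) ^ (2 * ?d + 2) \<le> ((1 + h) * (1 + norm ?z)) ^ (2 * ?d + 2)"
      by (intro power_mono) auto
    then have *: "(1 + norm y) ^ (2 * ?d + 2) \<le> (1 + h) ^ (2 * ?d + 2) * (1 + norm ?z) ^ (2 * ?d + 2)"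
      by (simp only: power_mult_distrib)
    have pos: "0 < (1 + norm y) ^ j" "0 < (1 + norm ?z) ^ j" for j
      by (simp_all add: add_pos_nonneg)
    have "norm (p ?z) \<le> C / (1 + norm ?z) ^ (2 * ?d + 2)" by (rule decay)
    also have "\<dots> \<le> C * (1 + h) ^ (2 * ?d + 2) / (1 + norm y) ^ (2 * ?d + 2)"
      using mult_left_mono[OF * C] pos(1)[of "2 * ?d + 2"] pos(2)[of "2 * ?d + 2"]
      by (simp add: pos_le_divide_eq pos_divide_le_eq mult_ac del: power_Suc power_add power_mult add_2_eq_Suc')
    finally have "norm (cell_mean h f y * p ?z)
        \<le> K * (1 + norm y) ^ ?d * (C * (1 + h) ^ (2 * ?d + 2) / (1 + norm y) ^ (2 * ?d + 2))"
      unfolding norm_mult using K pos(1)[of ?d] by (intro mult_mono) auto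
    also have "\<dots> = K * C * (1 + h) ^ (2 * ?d + 2) / (1 + norm y) ^ (?d + 2)"
    proof -
      have "2 * ?d + 2 = ?d + (?d + 2)" by simp
      then have "(1 + norm y) ^ (2 * ?d + 2) = (1 + norm y) ^ ?d * (1 + norm y) ^ (?d + 2)"
        by (simp only: power_add)
      then show ?thesis using pos(1)[of ?d] pos(1)[of "?d + 2"] by (simp add: field_simps del: power_Suc add_2_eq_Suc')
    qed
    finally show "norm (cell_mean h f y * p ?z) \<le> K * C * (1 + h) ^ (2 * ?d + 2) / (1 + norm y) ^ (?d + 2)" .
  qed
qed

text \<open>With \<open>J s = \<integral> A(y) \<partial>\<^sub>i w(y - s e\<^sub>i) dy\<close>, a translation gives \<open>J s = \<integral> A(y + s e\<^sub>i) \<partial>\<^sub>i w(y) dy\<close>. Hence \<open>J s\<close>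
  stays within \<open>2 D M \<integral> \<bar>\<partial>\<^sub>i w\<bar>\<close> of \<open>J 0\<close>, the integral to be bounded. On the other hand
  \<open>\<integral>\<^sub>0\<^sup>h J s ds = \<integral> A(y) (w(y) - w(y - h e\<^sub>i)) dy = \<integral> (A(y) - A(y + h e\<^sub>i)) w(y) dy\<close>, where the difference of
  \<open>A\<close> is bounded.\<close>

theorem cell_mean_derivative_pairing:
  fixes w :: "real^'n \<Rightarrow> complex"
  assumes "C1_function w" "0 < h"
    and decay: "\<And>x. norm (w x) \<le> C / (1 + norm x) ^ (2 * CARD('n) + 2)"
    and decay': "\<And>x. norm (partial i w x) \<le> C / (1 + norm x) ^ (2 * CARD('n) + 2)"
  shows "integrable lborel (\<lambda>x. cell_mean h f x * partial i w x)"
    and "h * norm (LINT x|lborel. cell_mean h f x * partial i w x)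
      \<le> 2 * (D * M) * (h * (LINT x|lborel. norm (partial i w x)) + (LINT x|lborel. norm (w x)))"
proof -
  interpret w: C1_function w by (rule assms(1))
  let ?A = "cell_mean h f" and ?p = "partial i w" and ?e = "axis i 1 :: real^'n"
  have [measurable]: "?p \<in> borel_measurable borel"
    by (rule borel_measurable_continuous_onI[OF w.continuous_partial])
  obtain B where "\<forall>s\<in>{0..h}. \<forall>y. norm (?A y * ?p (y - s *\<^sub>R ?e)) \<le> B / (1 + norm y) ^ (CARD('n) + 2)"
    using cell_mean_shifted_decay[OF assms(2) _ decay', of i] by (meson \<open>?p \<in> borel_measurable borel\<close> w.u_measurable)
  then have B: "norm (?A y * ?p (y - s *\<^sub>R ?e)) \<le> B / (1 + norm y) ^ (CARD('n) + 2)" if "0 \<le> s" "s \<le> h" for s y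
    using that by (simp del: power_Suc add_2_eq_Suc')
  obtain B' where "\<forall>s\<in>{0..h}. \<forall>y. norm (?A y * w (y - s *\<^sub>R ?e)) \<le> B' / (1 + norm y) ^ (CARD('n) + 2)"
    using cell_mean_shifted_decay[OF assms(2) _ decay, of i] by (meson \<open>?p \<in> borel_measurable borel\<close> w.u_measurable)
  then have B': "norm (?A y * w (y - s *\<^sub>R ?e)) \<le> B' / (1 + norm y) ^ (CARD('n) + 2)" if "0 \<le> s" "s \<le> h" for s y
    using that by (simp del: power_Suc add_2_eq_Suc')
  have weaken: "C / (1 + norm x) ^ (2 * CARD('n) + 2) \<le> C / (1 + norm x) ^ (CARD('n) + 2)" for x :: "real^'n"
  proof -
    have "0 \<le> C" using order_trans[OF norm_ge_zero decay[of 0]] by simp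
    then show ?thesis
      by (intro divide_left_mono power_increasing mult_pos_pos zero_less_power) (auto simp: add_pos_nonneg)
  qed
  have int_p: "integrable lborel ?p"
    by (rule integrable_decay[OF _ order_trans[OF decay' weaken]]) simp
  have int_w: "integrable lborel w"
    by (rule integrable_decay[OF _ order_trans[OF decay weaken]]) simp
  have int: "integrable lborel (\<lambda>y. ?A y * ?p (y - s *\<^sub>R ?e))" if "0 \<le> s" "s \<le> h" for s
    by (rule integrable_decay[OF _ B[OF that]]) measurable
  have int': "integrable lborel (\<lambda>y. ?A y * w (y - s *\<^sub>R ?e))" if "0 \<le> s" "s \<le> h" for s
    by (rule integrable_decay[OF _ B'[OF that]]) measurable
  have shift: "(LINT y|lborel. ?A y * g (y - s *\<^sub>R ?e)) = (LINT y|lborel. ?A (y + s *\<^sub>R ?e) * g y)"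
    "integrable lborel (\<lambda>y. ?A y * g (y - s *\<^sub>R ?e)) \<Longrightarrow> integrable lborel (\<lambda>y. ?A (y + s *\<^sub>R ?e) * g y)"
    if [measurable]: "g \<in> borel_measurable borel" for g s
  proof -
    show "(LINT y|lborel. ?A y * g (y - s *\<^sub>R ?e)) = (LINT y|lborel. ?A (y + s *\<^sub>R ?e) * g y)"
      using integral_translate[of "\<lambda>y. ?A y * g (y - s *\<^sub>R ?e)" "s *\<^sub>R ?e"] by simp
    assume "integrable lborel (\<lambda>y. ?A y * g (y - s *\<^sub>R ?e))"
    then have "integrable (distr lborel borel ((+) (s *\<^sub>R ?e))) (\<lambda>y. ?A y * g (y - s *\<^sub>R ?e))"
      by (simp add: lborel_distr_plus)
    then show "integrable lborel (\<lambda>y. ?A (y + s *\<^sub>R ?e) * g y)"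
      by (subst (asm) integrable_distr_eq) (simp_all add: add.commute)
  qed
  define J where "J s = (LINT y|lborel. ?A y * ?p (y - s *\<^sub>R ?e))" for s
  show int0: "integrable lborel (\<lambda>x. ?A x * ?p x)" using int[of 0] assms(2) by simp
  have osc: "norm ((?A (y + s *\<^sub>R ?e) - ?A y) * g y) \<le> 2 * (D * M) * norm (g y)"
    if "0 \<le> s" "s \<le> h" for g :: "real^'n \<Rightarrow> complex" and s y
    unfolding norm_mult using cell_mean_shift[OF assms(2) that] by (intro mult_right_mono) auto
  have osc_int: "norm ((LINT y|lborel. ?A (y + s *\<^sub>R ?e) * g y) - (LINT y|lborel. ?A y * g y))
      \<le> 2 * (D * M) * (LINT y|lborel. norm (g y))"
    if s: "0 \<le> s" "s \<le> h" and g: "integrable lborel g" "integrable lborel (\<lambda>y. ?A (y + s *\<^sub>R ?e) * g y)"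
      "integrable lborel (\<lambda>y. ?A y * g y)" for g s
  proof -
    have "(LINT y|lborel. ?A (y + s *\<^sub>R ?e) * g y) - (LINT y|lborel. ?A y * g y)
        = (LINT y|lborel. (?A (y + s *\<^sub>R ?e) - ?A y) * g y)"
      using g by (simp add: left_diff_distrib)
    also have "norm \<dots> \<le> (LINT y|lborel. 2 * (D * M) * norm (g y))"
    proof (rule Bochner_Integration.integral_norm_bound_integral)
      show "integrable lborel (\<lambda>y. (?A (y + s *\<^sub>R ?e) - ?A y) * g y)"
        using g by (simp add: left_diff_distrib)
      show "integrable lborel (\<lambda>y. 2 * (D * M) * norm (g y))" using g by simp
    qed (rule osc[OF s])
    finally show ?thesis by simp
  qed
  have J_diff: "norm (J s - J 0) \<le> 2 * (D * M) * (LINT y|lborel. norm (?p y))" if "0 \<le> s" "s \<le> h" for s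
    using osc_int[OF that int_p shift(2)[OF _ int[OF that]] int0] shift(1)[of ?p s]
    by (simp add: J_def)
  have prod: "integrable (lborel \<Otimes>\<^sub>M lborel) (\<lambda>(s, y). indicator {0..h} s *\<^sub>R (?A y * ?p (y - s *\<^sub>R ?e)))"
  proof (rule integrableI_bounded)
    show "(\<lambda>(s, y). indicator {0..h} s *\<^sub>R (?A y * ?p (y - s *\<^sub>R ?e))) \<in> borel_measurable (lborel \<Otimes>\<^sub>M lborel)"
      by measurable
    have "(\<integral>\<^sup>+z. ennreal (norm (case z of (s, y) \<Rightarrow> indicator {0..h} s *\<^sub>R (?A y * ?p (y - s *\<^sub>R ?e)))) \<partial>(lborel \<Otimes>\<^sub>M lborel))
        \<le> (\<integral>\<^sup>+z. (case z of (s, y) \<Rightarrow> indicator {0..h} s * ennreal (\<bar>B\<bar> / (1 + norm y) ^ (CARD('n) + 2))) \<partial>((lborel :: real measure) \<Otimes>\<^sub>M (lborel :: (real^'n) measure)))"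
    proof (rule nn_integral_mono, safe)
      fix s :: real and y :: "real^'n"
      have "B / (1 + norm y) ^ (CARD('n) + 2) \<le> \<bar>B\<bar> / (1 + norm y) ^ (CARD('n) + 2)"
        by (intro divide_right_mono) auto
      then show "ennreal (norm (indicator {0..h} s *\<^sub>R (?A y * ?p (y - s *\<^sub>R ?e))))
          \<le> indicator {0..h} s * ennreal (\<bar>B\<bar> / (1 + norm y) ^ (CARD('n) + 2))"
        using B[of s y] by (auto intro!: ennreal_leI split: split_indicator)
    qed
    also have "\<dots> = (\<integral>\<^sup>+s. (\<integral>\<^sup>+y. indicator {0..h} s * ennreal (\<bar>B\<bar> / (1 + norm (y :: real^'n)) ^ (CARD('n) + 2)) \<partial>lborel) \<partial>(lborel :: real measure))"
      by (subst lborel.nn_integral_fst[symmetric]) auto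
    also have "\<dots> = (\<integral>\<^sup>+s. indicator {0..h} s * (ennreal \<bar>B\<bar> * (\<integral>\<^sup>+y. ennreal (1 / (1 + norm (y :: real^'n)) ^ (CARD('n) + 2)) \<partial>lborel)) \<partial>(lborel :: real measure))"
      by (intro nn_integral_cong) (simp add: nn_integral_cmult[symmetric] ennreal_mult[symmetric] del: power_Suc add_2_eq_Suc')
    also have "\<dots> = ennreal h * (ennreal \<bar>B\<bar> * (\<integral>\<^sup>+y. ennreal (1 / (1 + norm (y :: real^'n)) ^ (CARD('n) + 2)) \<partial>lborel))"
      using assms(2) by (subst nn_integral_multc) auto
    also have "\<dots> < \<infinity>"
      using nn_integral_decay_finite[where 'n = 'n] by (simp add: ennreal_mult_less_top)
    finally show "(\<integral>\<^sup>+z. ennreal (norm (case z of (s, y) \<Rightarrow> indicator {0..h} s *\<^sub>R (?A y * ?p (y - s *\<^sub>R ?e)))) \<partial>(lborel \<Otimes>\<^sub>M lborel)) < \<infinity>" .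
  qed
  have int_J: "integrable lborel (\<lambda>s. indicator {0..h} s *\<^sub>R J s)"
    and J_swap: "(LINT s|lborel. indicator {0..h} s *\<^sub>R J s)
      = (LINT y|lborel. (LINT s|lborel. indicator {0..h} s *\<^sub>R (?A y * ?p (y - s *\<^sub>R ?e))))"
    using lborel_pair.integrable_fst'[OF prod] lborel_pair.Fubini_integral[OF prod, symmetric]
    by (simp_all add: J_def)
  \<comment> \<open>Integrating the derivative over the shift \<open>s\<close> leaves a difference of two values of \<open>w\<close>.\<close>
  have FTC: "(LINT s|lborel. indicator {0..h} s *\<^sub>R (?A y * ?p (y - s *\<^sub>R ?e))) = ?A y * (w y - w (y - h *\<^sub>R ?e))" for y
  proof -
    have deriv: "((\<lambda>s. - (?A y * w (y - s *\<^sub>R ?e))) has_vector_derivative ?A y * ?p (y - s *\<^sub>R ?e)) (at s within {0..h})" for s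
    proof -
      have "(\<Sum>j\<in>UNIV. (- ?e) $ j *\<^sub>R partial j w x) = - ?p x" for x
      proof -
        have "(- ?e) $ j *\<^sub>R partial j w x = (if j = i then - ?p x else 0)" for j
          by (simp add: axis_def)
        then show ?thesis by (simp only: sum.delta finite UNIV_I if_True)
      qed
      then have "((\<lambda>s. w (y - s *\<^sub>R ?e)) has_vector_derivative - ?p (y - s *\<^sub>R ?e)) (at s within {0..h})"
        using w.has_directional_derivative[of y "- ?e" s "{0..h}"] by simp
      from has_vector_derivative_mult_right[OF this, of "- ?A y"] show ?thesis by simp
    qed
    have cont: "continuous_on {0..h} (\<lambda>s. ?A y * ?p (y - s *\<^sub>R ?e))"
      by (intro continuous_intros continuous_on_compose2[OF w.continuous_partial]) auto
    show ?thesis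
      using integral_FTC_atLeastAtMost[OF less_imp_le[OF assms(2)] deriv cont] by (simp add: right_diff_distrib)
  qed
  have "norm (LINT s|lborel. indicator {0..h} s *\<^sub>R J s) \<le> 2 * (D * M) * (LINT x|lborel. norm (w x))"
  proof -
    have "(LINT s|lborel. indicator {0..h} s *\<^sub>R J s) = (LINT y|lborel. ?A y * w y) - (LINT y|lborel. ?A y * w (y - h *\<^sub>R ?e))"
      unfolding J_swap FTC right_diff_distrib using int'[of 0] int'[of h] assms(2) by simp
    also have "norm \<dots> \<le> 2 * (D * M) * (LINT x|lborel. norm (w x))"
      using osc_int[OF _ _ int_w shift(2)[OF _ int'[of h]]] int'[of 0] assms(2) shift(1)[of w h]
      by (simp add: norm_minus_commute)
    finally show ?thesis .
  qed
  moreover have "norm (h *\<^sub>R J 0 - (LINT s|lborel. indicator {0..h} s *\<^sub>R J s)) \<le> h * (2 * (D * M) * (LINT y|lborel. norm (?p y)))"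
  proof -
    have const: "integrable lborel (\<lambda>s. indicator {0..h} s *\<^sub>R c)" "(LINT s|lborel. indicator {0..h} s *\<^sub>R c) = h *\<^sub>R c"
      for c :: "'b::euclidean_space"
      using assms(2) by (auto intro!: integrable_scaleR_left integrable_real_indicator)
    have "h *\<^sub>R J 0 - (LINT s|lborel. indicator {0..h} s *\<^sub>R J s) = (LINT s|lborel. indicator {0..h} s *\<^sub>R (J 0 - J s))"
      unfolding scaleR_diff_right using const[of "J 0"] int_J by simp
    also have "norm \<dots> \<le> (LINT s|lborel. indicator {0..h} s *\<^sub>R (2 * (D * M) * (LINT y|lborel. norm (?p y))))"
    proof (rule Bochner_Integration.integral_norm_bound_integral)
      show "integrable lborel (\<lambda>s. indicator {0..h} s *\<^sub>R (J 0 - J s))"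
        unfolding scaleR_diff_right using const[of "J 0"] int_J by simp
      show "norm (indicator {0..h} s *\<^sub>R (J 0 - J s)) \<le> indicator {0..h} s *\<^sub>R (2 * (D * M) * (LINT y|lborel. norm (?p y)))" for s
        using J_diff[of s] by (auto simp: norm_minus_commute split: split_indicator)
    qed (rule const)
    also have "\<dots> = h *\<^sub>R (2 * (D * M) * (LINT y|lborel. norm (?p y)))"
      by (rule const(2))
    finally show ?thesis by simp
  qed
  ultimately have "norm (h *\<^sub>R J 0) \<le> 2 * (D * M) * (LINT x|lborel. norm (w x)) + h * (2 * (D * M) * (LINT y|lborel. norm (?p y)))"
    by (smt (verit) norm_triangle_ineq2)
  then show "h * norm (LINT x|lborel. ?A x * ?p x) \<le> 2 * (D * M) * (h * (LINT x|lborel. norm (?p x)) + (LINT x|lborel. norm (w x)))"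
    using assms(2) by (simp add: J_def algebra_simps)
qed

end

section \<open>The square of a Schwartz function\<close>

lemma partial_add:
  assumes "f differentiable at x" "g differentiable at x"
  shows "partial i (\<lambda>x. f x + g x) x = partial i f x + partial i g x"
  using assms unfolding differentiable_def
  by (auto simp: partial_eq_derivative[OF has_derivative_add] partial_eq_derivative)

lemma partial_mult:
  assumes "f differentiable at x" "g differentiable at x"
  shows "partial i (\<lambda>x. f x * g x) x = f x * partial i g x + partial i f x * g x"
  using assms unfolding differentiable_def
  by (auto simp: partial_eq_derivative[OF has_derivative_mult] partial_eq_derivative)

lemma partial_cnj:
  assumes "f differentiable at x"
  shows "partial i (\<lambda>x. cnj (f x)) x = cnj (partial i f x)"
  using assms unfolding differentiable_def
  by (auto simp: partial_eq_derivative[OF has_derivative_cnj] partial_eq_derivative)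

lemma differentiable_cnj: "f differentiable at x \<Longrightarrow> (\<lambda>x. cnj (f x)) differentiable at x"
  unfolding differentiable_def by (blast intro: has_derivative_cnj)

lemma partials_Nil [simp]: "partials [] f = f"
  and partials_Cons [simp]: "partials (i # \<alpha>) f = partial i (partials \<alpha> f)"
  and partials_partial: "partials \<alpha> (partial i f) = partials (\<alpha> @ [i]) f"
  by (simp_all add: partials_def)

definition rapidly_decreasing :: "(real^'n::finite \<Rightarrow> complex) \<Rightarrow> bool" where
  "rapidly_decreasing f \<longleftrightarrow> (\<forall>m. bdd_above (range (\<lambda>x. (1 + norm x) ^ m * norm (f x))))"

lemma rapidly_decreasingE:
  assumes "rapidly_decreasing f"
  obtains C where "0 \<le> C" "\<And>x. (1 + norm x) ^ m * norm (f x) \<le> C"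
proof -
  obtain C where C: "\<And>x. (1 + norm x) ^ m * norm (f x) \<le> C"
    using assms unfolding rapidly_decreasing_def bdd_above_def by auto
  have "0 \<le> (1 + norm (0::real^'a)) ^ m * norm (f 0)" by simp
  also have "\<dots> \<le> C" by (rule C)
  finally show ?thesis using C that by blast
qed

lemma rapidly_decreasingI:
  assumes "\<And>m. \<exists>C. \<forall>x. (1 + norm x) ^ m * norm (f x) \<le> C"
  shows "rapidly_decreasing f"
  unfolding rapidly_decreasing_def bdd_above_def using assms by auto

lemma rapidly_decreasing_mult:
  assumes "rapidly_decreasing f" "rapidly_decreasing g"
  shows "rapidly_decreasing (\<lambda>x. f x * g x)"
proof (rule rapidly_decreasingI)
  fix m
  obtain A where A: "0 \<le> A" "\<And>x. (1 + norm x) ^ m * norm (f x) \<le> A"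
    using rapidly_decreasingE[OF assms(1)] by blast
  obtain B where B: "0 \<le> B" "\<And>x. (1 + norm x) ^ 0 * norm (g x) \<le> B"
    using rapidly_decreasingE[OF assms(2)] by blast
  have "(1 + norm x) ^ m * norm (f x * g x) \<le> A * B" for x
    using mult_mono[OF A(2)[of x] _ A(1), of "norm (g x)" B] B(2)[of x] by (simp add: norm_mult mult.assoc)
  then show "\<exists>C. \<forall>x. (1 + norm x) ^ m * norm (f x * g x) \<le> C" by blast
qed

lemma rapidly_decreasing_add:
  assumes "rapidly_decreasing f" "rapidly_decreasing g"
  shows "rapidly_decreasing (\<lambda>x. f x + g x)"
proof (rule rapidly_decreasingI)
  fix m
  obtain A where A: "\<And>x. (1 + norm x) ^ m * norm (f x) \<le> A"
    using rapidly_decreasingE[OF assms(1)] by blast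
  obtain B where B: "\<And>x. (1 + norm x) ^ m * norm (g x) \<le> B"
    using rapidly_decreasingE[OF assms(2)] by blast
  have "(1 + norm x) ^ m * norm (f x + g x) \<le> A + B" for x
  proof -
    have "(1 + norm x) ^ m * norm (f x + g x) \<le> (1 + norm x) ^ m * (norm (f x) + norm (g x))"
      by (intro mult_left_mono norm_triangle_ineq) simp
    also have "\<dots> \<le> A + B" using A[of x] B[of x] by (simp add: distrib_left)
    finally show ?thesis .
  qed
  then show "\<exists>C. \<forall>x. (1 + norm x) ^ m * norm (f x + g x) \<le> C" by blast
qed

lemma schwartz_iff:
  "f \<in> schwartz \<longleftrightarrow> (\<forall>\<alpha>. (\<forall>x. partials \<alpha> f differentiable at x) \<and> rapidly_decreasing (partials \<alpha> f))"
  by (auto simp: schwartz_def rapidly_decreasing_def)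

lemma schwartz_differentiable: "f \<in> schwartz \<Longrightarrow> f differentiable at x"
  using schwartz_iff[of f] partials_Nil[of f] by metis

lemma schwartz_decreasing: "f \<in> schwartz \<Longrightarrow> rapidly_decreasing f"
  using schwartz_iff[of f] partials_Nil[of f] by metis

lemma schwartz_partial: "f \<in> schwartz \<Longrightarrow> partial i f \<in> schwartz"
  by (simp add: schwartz_iff partials_partial)

lemma schwartz_cnj:
  assumes "f \<in> schwartz"
  shows "(\<lambda>x. cnj (f x)) \<in> schwartz"
proof -
  have "partials \<alpha> (\<lambda>x. cnj (f x)) = (\<lambda>x. cnj (partials \<alpha> f x))" for \<alpha>
  proof (induction \<alpha>)
    case (Cons i \<alpha>)
    then show ?case using assms by (simp add: schwartz_iff partial_cnj)
  qed simp
  then show ?thesis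
    using assms by (auto simp: schwartz_iff differentiable_cnj rapidly_decreasing_def)
qed

text \<open>By the product rule, a partial derivative of a product is a sum of products. This set is
  closed under partial derivatives, which replaces the Leibniz formula for multi-indices.\<close>

inductive_set schwartz_products :: "(real^'n::finite \<Rightarrow> complex) set" where
  mult: "f \<in> schwartz \<Longrightarrow> g \<in> schwartz \<Longrightarrow> (\<lambda>x. f x * g x) \<in> schwartz_products"
| add: "F \<in> schwartz_products \<Longrightarrow> G \<in> schwartz_products \<Longrightarrow> (\<lambda>x. F x + G x) \<in> schwartz_products"

lemma schwartz_products_regular:
  assumes "F \<in> schwartz_products"
  shows "(\<forall>x. F differentiable at x) \<and> rapidly_decreasing F \<and> partial i F \<in> schwartz_products"
  using assms
proof induction
  case (mult f g)
  then have "partial i (\<lambda>x. f x * g x) = (\<lambda>x. f x * partial i g x + partial i f x * g x)"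
    by (simp add: fun_eq_iff partial_mult schwartz_differentiable)
  then show ?case
    using mult by (auto intro!: schwartz_products.intros schwartz_partial
        rapidly_decreasing_mult[OF schwartz_decreasing schwartz_decreasing]
        differentiable_mult[OF schwartz_differentiable schwartz_differentiable])
next
  case (add F G)
  then have "partial i (\<lambda>x. F x + G x) = (\<lambda>x. partial i F x + partial i G x)"
    by (simp add: fun_eq_iff partial_add)
  then show ?case
    using add by (auto intro!: schwartz_products.intros rapidly_decreasing_add differentiable_add)
qed

theorem schwartz_mult:
  assumes "f \<in> schwartz" "g \<in> schwartz"
  shows "(\<lambda>x. f x * g x) \<in> schwartz"
proof -
  have "partials \<alpha> (\<lambda>x. f x * g x) \<in> schwartz_products" for \<alpha>
    by (induction \<alpha>) (auto simp: schwartz_products_regular intro: schwartz_products.mult assms)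
  then show ?thesis
    using schwartz_products_regular by (auto simp: schwartz_iff)
qed

lemma schwartz_C1:
  assumes "f \<in> schwartz"
  shows "C1_function f"
proof
  show "continuous_on UNIV (partial i f)" for i
    by (meson continuous_at_imp_continuous_on differentiable_imp_continuous_within
        schwartz_differentiable[OF schwartz_partial[OF assms]])
qed (rule schwartz_differentiable[OF assms])

lemma schwartz_decay:
  assumes "f \<in> schwartz"
  obtains C where "\<And>x. norm (f x) \<le> C / (1 + norm x) ^ m"
proof -
  obtain C where C: "\<And>x. (1 + norm x) ^ m * norm (f x) \<le> C"
    using rapidly_decreasingE[OF schwartz_decreasing[OF assms]] by blast
  have "0 < (1 + norm x) ^ m" for x :: "real^'a" by (simp add: add_pos_nonneg)
  then show ?thesis
    using C by (intro that[of C]) (simp add: pos_le_divide_eq mult.commute)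
qed

lemma schwartz_integrable_square:
  assumes "f \<in> schwartz"
  shows "integrable lborel (\<lambda>x. (norm (f x))\<^sup>2)"
proof -
  interpret C1_function f by (rule schwartz_C1[OF assms])
  obtain C where C: "\<And>x. norm (f x * f x) \<le> C / (1 + norm x) ^ (CARD('a) + 2)"
    using schwartz_decay[OF schwartz_mult[OF assms assms]] by blast
  show ?thesis
    by (rule integrable_decay[of _ C]) (use C in \<open>simp_all add: norm_mult power2_eq_square\<close>)
qed

section \<open>The bilinear estimate\<close>

text \<open>The optimal choice is \<open>h = X / Y\<close>. If \<open>Y\<close> or \<open>X\<close> vanishes, the bound tends to \<open>0\<close> as \<open>h\<close> tends to
  infinity or to zero.\<close>

lemma optimise_scale:
  fixes a C X Y :: real
  assumes nonneg: "0 \<le> C" "0 \<le> X" "0 \<le> Y"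
    and bound: "\<And>h. 0 < h \<Longrightarrow> a \<le> C * (X * Y + h * Y\<^sup>2 + X\<^sup>2 / h)"
  shows "a \<le> 3 * C * X * Y"
proof -
  consider "0 < X" "0 < Y" | "Y = 0" | "X = 0" using nonneg by linarith
  then show ?thesis
  proof cases
    case 1
    then show ?thesis using bound[of "X / Y"] by (simp add: field_simps power2_eq_square)
  next
    case 2
    show ?thesis
    proof (rule ccontr)
      assume "\<not> ?thesis"
      then have a: "0 < a" by (simp add: 2)
      have "0 \<le> C * X\<^sup>2" using nonneg by simp
      then have "0 < (C * X\<^sup>2 + 1) / a" using a by simp
      from bound[OF this] have "a \<le> C * X\<^sup>2 / ((C * X\<^sup>2 + 1) / a)" by (simp add: 2)
      with a \<open>0 \<le> C * X\<^sup>2\<close> show False by (simp add: field_simps split: if_splits)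
    qed
  next
    case 3
    show ?thesis
    proof (rule ccontr)
      assume "\<not> ?thesis"
      then have a: "0 < a" by (simp add: 3)
      have "0 \<le> C * Y\<^sup>2" using nonneg by simp
      then have "0 < a / (C * Y\<^sup>2 + 1)" using a by simp
      from bound[OF this] have "a \<le> C * Y\<^sup>2 * (a / (C * Y\<^sup>2 + 1))" by (simp add: 3 mult_ac)
      with a \<open>0 \<le> C * Y\<^sup>2\<close> show False by (simp add: field_simps split: if_splits)
    qed
  qed
qed

lemma partial_square:
  assumes "\<psi> \<in> schwartz"
  shows "norm (partial i (\<lambda>x. \<psi> x * cnj (\<psi> x)) x) \<le> 2 * (norm (\<psi> x) * norm (grad \<psi> x))"
proof -
  have d: "\<psi> differentiable at x" by (rule schwartz_differentiable[OF assms])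
  have "norm (partial i (\<lambda>x. \<psi> x * cnj (\<psi> x)) x)
      \<le> norm (\<psi> x) * norm (partial i \<psi> x) + norm (partial i \<psi> x) * norm (\<psi> x)"
    unfolding partial_mult[OF d differentiable_cnj[OF d]] partial_cnj[OF d]
    by (rule order_trans[OF norm_triangle_ineq]) (simp add: norm_mult)
  moreover have "norm (partial i \<psi> x) \<le> norm (grad \<psi> x)"
    using Finite_Cartesian_Product.norm_nth_le[of "grad \<psi> x" i] by (simp add: grad_def)
  ultimately show ?thesis
    using mult_left_mono[of "norm (partial i \<psi> x)" "norm (grad \<psi> x)" "norm (\<psi> x)"] by (simp add: mult.commute)
qed

lemma l2_norm_square:
  fixes F :: "real^'n::finite \<Rightarrow> 'b::euclidean_space"
  assumes [measurable]: "F \<in> borel_measurable borel" and "integrable lborel (\<lambda>x. (norm (F x))\<^sup>2)"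
  shows "(\<integral>\<^sup>+x. ennreal ((norm (F x))\<^sup>2) \<partial>lborel) = ennreal ((l2_norm F)\<^sup>2)"
proof -
  have "(LINT x|lebesgue. (norm (F x))\<^sup>2) = (LINT x|lborel. (norm (F x))\<^sup>2)"
    by (rule integral_completion) measurable
  then show ?thesis
    using assms by (simp add: l2_norm_def nn_integral_eq_integral)
qed

lemma l2_norm_nonneg: "0 \<le> l2_norm F"
  by (simp add: l2_norm_def)

lemma schwartz_grad_square_integrable:
  assumes "\<psi> \<in> schwartz"
  shows "integrable lborel (\<lambda>x. (norm (grad \<psi> x))\<^sup>2)"
proof -
  have "(norm (grad \<psi> x))\<^sup>2 = (\<Sum>i\<in>UNIV. (norm (partial i \<psi> x))\<^sup>2)" for x
    by (simp add: norm_vec_def L2_set_def sum_nonneg grad_def)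
  then show ?thesis
    using schwartz_integrable_square[OF schwartz_partial[OF assms]] by simp
qed

text \<open>Extracts the root from the square in which the Cauchy-Schwarz inequality for nonnegative
  integrals is stated.\<close>

lemma le_of_square_le_ennreal:
  assumes "a\<^sup>2 \<le> ennreal (b\<^sup>2)" "0 \<le> b"
  shows "a \<le> ennreal b"
proof (rule ccontr)
  assume "\<not> a \<le> ennreal b"
  then have less: "ennreal b < a" by simp
  have "a < top"
  proof (rule ccontr)
    assume "\<not> a < top"
    then have "a = top" by (meson top.not_eq_extremum)
    with assms(1) show False by (simp add: power2_eq_square ennreal_mult_top top_unique)
  qed
  then obtain r where r: "a = ennreal r" "0 \<le> r" by (cases a) auto
  with less assms(2) have "b < r" by (simp add: ennreal_less_iff)
  with assms(2) have "b\<^sup>2 < r\<^sup>2" by (intro power_strict_mono) auto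
  with assms(1) r show False by (simp add: ennreal_power)
qed

context bounded_mean_oscillation begin

text \<open>The small scales: \<open>(f - A) \<psi>\<close> is square integrable, and so is the gradient. In particular
  \<open>(f - A) \<partial>\<^sub>i \<bar>\<psi>\<bar>\<^sup>2\<close> is integrable.\<close>

lemma oscillation_part:
  fixes h :: real
  assumes \<psi>: "\<psi> \<in> schwartz" and h: "0 < h"
  shows "(\<integral>\<^sup>+x. ennreal (norm (f x - cell_mean h f x) * norm (\<psi> x) * norm (grad \<psi> x)) \<partial>lebesgue)
    \<le> ennreal (sqrt (240 * weight_const * (1 + D * CARD('n))) * (l2_norm \<psi> + h * l2_norm (grad \<psi>)) * l2_norm (grad \<psi>))"
proof (rule le_of_square_le_ennreal)
  interpret \<psi>: C1_function \<psi> by (rule schwartz_C1[OF \<psi>])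
  have [measurable]: "\<psi> \<in> borel_measurable lebesgue" "grad \<psi> \<in> borel_measurable lebesgue"
    using \<psi>.u_measurable \<psi>.grad_measurable by (simp_all add: measurable_completion)
  define X Y where "X = l2_norm \<psi>" and "Y = l2_norm (grad \<psi>)"
  have XY: "0 \<le> X" "0 \<le> Y" by (simp_all add: X_def Y_def l2_norm_nonneg)
  have X2: "(\<integral>\<^sup>+x. ennreal ((norm (\<psi> x))\<^sup>2) \<partial>lebesgue) = ennreal (X\<^sup>2)"
    unfolding nn_integral_completion X_def
    by (rule l2_norm_square[OF \<psi>.u_measurable schwartz_integrable_square[OF \<psi>]])
  have Y2: "(\<integral>\<^sup>+x. ennreal ((norm (grad \<psi> x))\<^sup>2) \<partial>lebesgue) = ennreal (Y\<^sup>2)"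
    unfolding nn_integral_completion Y_def
    by (rule l2_norm_square[OF \<psi>.grad_measurable schwartz_grad_square_integrable[OF \<psi>]])
  let ?o = "\<lambda>x. norm (f x - cell_mean h f x)" and ?g = "\<lambda>x. norm (grad \<psi> x)"
  have "(\<integral>\<^sup>+x. ennreal (?o x * norm (\<psi> x) * ?g x) \<partial>lebesgue)\<^sup>2
      = (\<integral>\<^sup>+x. ennreal (?o x * norm (\<psi> x)) * ennreal (?g x) \<partial>lebesgue)\<^sup>2"
    by (simp add: ennreal_mult)
  also have "\<dots> \<le> (\<integral>\<^sup>+x. (ennreal (?o x * norm (\<psi> x)))\<^sup>2 \<partial>lebesgue) * (\<integral>\<^sup>+x. (ennreal (?g x))\<^sup>2 \<partial>lebesgue)"
    by (rule Cauchy_Schwarz_nn_integral) measurable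
  also have "(\<integral>\<^sup>+x. (ennreal (?g x))\<^sup>2 \<partial>lebesgue) = ennreal (Y\<^sup>2)"
    using Y2 by (simp add: ennreal_power)
  also have "(\<integral>\<^sup>+x. (ennreal (?o x * norm (\<psi> x)))\<^sup>2 \<partial>lebesgue)
      = (\<integral>\<^sup>+x. ennreal ((?o x)\<^sup>2) * ennreal ((norm (\<psi> x))\<^sup>2) \<partial>lebesgue)"
    by (simp add: ennreal_power power_mult_distrib ennreal_mult)
  also have "\<dots> \<le> ennreal (240 * weight_const) * (ennreal (X\<^sup>2)
      + ennreal (2 ^ CARD('n) * CARD('n) * h\<^sup>2) * ennreal (Y\<^sup>2))"
    using oscillation_multiplier[OF \<psi>.C1_function_axioms h] unfolding X2 Y2 .
  also have "\<dots> = ennreal (240 * weight_const * (X\<^sup>2 + D * CARD('n) * h\<^sup>2 * Y\<^sup>2))"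
    using weight_const_nonneg D_nonneg
    by (simp add: D_eq ennreal_mult[symmetric] ennreal_plus[symmetric] del: ennreal_plus)
  also have "\<dots> \<le> ennreal (240 * weight_const * ((1 + D * CARD('n)) * (X + h * Y)\<^sup>2))"
  proof (intro ennreal_leI mult_left_mono)
    have "X\<^sup>2 \<le> (X + h * Y)\<^sup>2" "h\<^sup>2 * Y\<^sup>2 \<le> (X + h * Y)\<^sup>2"
      using XY h unfolding power_mult_distrib[symmetric] by (intro power_mono; simp)+
    then have "X\<^sup>2 + D * CARD('n) * (h\<^sup>2 * Y\<^sup>2) \<le> (X + h * Y)\<^sup>2 + D * CARD('n) * (X + h * Y)\<^sup>2"
      using D_nonneg by (intro add_mono mult_left_mono) auto
    then show "X\<^sup>2 + D * CARD('n) * h\<^sup>2 * Y\<^sup>2 \<le> (1 + D * CARD('n)) * (X + h * Y)\<^sup>2"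
      by (simp add: distrib_right mult.assoc)
  qed (use weight_const_nonneg in simp)
  finally have "(\<integral>\<^sup>+x. ennreal (?o x * norm (\<psi> x) * ?g x) \<partial>lebesgue)\<^sup>2
      \<le> ennreal (240 * weight_const * ((1 + D * CARD('n)) * (X + h * Y)\<^sup>2)) * ennreal (Y\<^sup>2)"
    by (simp add: mult_right_mono)
  also have "\<dots> = ennreal ((sqrt (240 * weight_const * (1 + D * CARD('n))) * (X + h * Y) * Y)\<^sup>2)"
    using weight_const_nonneg D_nonneg by (simp add: power_mult_distrib ennreal_mult[symmetric] mult_ac)
  finally show "(\<integral>\<^sup>+x. ennreal (?o x * norm (\<psi> x) * ?g x) \<partial>lebesgue)\<^sup>2
      \<le> ennreal ((sqrt (240 * weight_const * (1 + D * CARD('n))) * (l2_norm \<psi> + h * l2_norm (grad \<psi>)) * l2_norm (grad \<psi>))\<^sup>2)"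
    by (simp add: X_def Y_def)
qed (use weight_const_nonneg D_nonneg h in \<open>simp add: l2_norm_nonneg\<close>)

text \<open>The estimates for \<open>A\<close> and for \<open>f - A\<close> are added and the mesh is optimised. Their integrability
  statements also show that \<open>f \<partial>\<^sub>i \<bar>\<psi>\<bar>\<^sup>2\<close> is integrable, so the left-hand side is not a default value.\<close>

theorem derivative_pairing_le:
  assumes \<psi>: "\<psi> \<in> schwartz"
  shows "norm (LINT x|lebesgue. f x * partial i (\<lambda>x. \<psi> x * cnj (\<psi> x)) x)
    \<le> 3 * (2 * sqrt (240 * weight_const * (1 + D * CARD('n))) + 4 * (D * M)) * l2_norm \<psi> * l2_norm (grad \<psi>)"
proof (rule optimise_scale)
  interpret \<psi>: C1_function \<psi> by (rule schwartz_C1[OF \<psi>])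
  define w where "w = (\<lambda>x. \<psi> x * cnj (\<psi> x))"
  have w: "w \<in> schwartz" unfolding w_def by (intro schwartz_mult schwartz_cnj \<psi>)
  interpret w: C1_function w by (rule schwartz_C1[OF w])
  have w_partial: "norm (partial i w x) \<le> 2 * (norm (\<psi> x) * norm (grad \<psi> x))" for x
    unfolding w_def by (rule partial_square[OF \<psi>])
  have [measurable]: "\<psi> \<in> borel_measurable lebesgue" "grad \<psi> \<in> borel_measurable lebesgue"
    using \<psi>.u_measurable \<psi>.grad_measurable by (simp_all add: measurable_completion)
  define X Y where "X = l2_norm \<psi>" and "Y = l2_norm (grad \<psi>)"
  define c where "c = sqrt (240 * weight_const * (1 + D * CARD('n)))"
  have XY: "0 \<le> X" "0 \<le> Y" by (simp_all add: X_def Y_def l2_norm_nonneg)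
  have c: "0 \<le> c" using weight_const_nonneg D_nonneg by (simp add: c_def)
  have DM: "0 \<le> D * M" using D_nonneg M_pos by simp
  have [measurable]: "partial i w \<in> borel_measurable borel"
    by (rule borel_measurable_continuous_onI[OF w.continuous_partial])
  then have [measurable]: "partial i w \<in> borel_measurable lebesgue"
    by (simp add: measurable_completion)
  obtain C0 where C0: "\<And>x. norm (w x) \<le> C0 / (1 + norm x) ^ (2 * CARD('n) + 2)"
    using schwartz_decay[OF w] by blast
  obtain C1 where C1: "\<And>x. norm (partial i w x) \<le> C1 / (1 + norm x) ^ (2 * CARD('n) + 2)"
    using schwartz_decay[OF schwartz_partial[OF w]] by blast
  have C0': "norm (w x) \<le> max C0 C1 / (1 + norm x) ^ (2 * CARD('n) + 2)"
    and C1': "norm (partial i w x) \<le> max C0 C1 / (1 + norm x) ^ (2 * CARD('n) + 2)" for x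
    by (rule order_trans[OF C0 divide_right_mono] order_trans[OF C1 divide_right_mono]; simp)+
  have int_w: "(LINT x|lborel. norm (w x)) = X\<^sup>2"
  proof -
    have "(LINT x|lborel. norm (w x)) = (LINT x|lebesgue. (norm (\<psi> x))\<^sup>2)"
      by (subst integral_completion) (simp_all add: w_def norm_mult power2_eq_square)
    then show ?thesis by (simp add: X_def l2_norm_def)
  qed
  have int_p: "(LINT x|lborel. norm (partial i w x)) \<le> 2 * (X * Y)"
  proof -
    have "(\<integral>\<^sup>+x. ennreal (norm (\<psi> x)) * ennreal (norm (grad \<psi> x)) \<partial>lborel)\<^sup>2
        \<le> (\<integral>\<^sup>+x. (ennreal (norm (\<psi> x)))\<^sup>2 \<partial>lborel) * (\<integral>\<^sup>+x. (ennreal (norm (grad \<psi> x)))\<^sup>2 \<partial>lborel)"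
      by (rule Cauchy_Schwarz_nn_integral) measurable
    also have "\<dots> = ennreal ((X * Y)\<^sup>2)"
      using l2_norm_square[OF \<psi>.u_measurable schwartz_integrable_square[OF \<psi>]]
        l2_norm_square[OF \<psi>.grad_measurable schwartz_grad_square_integrable[OF \<psi>]]
      by (simp add: ennreal_power X_def Y_def power_mult_distrib ennreal_mult)
    finally have CS: "(\<integral>\<^sup>+x. ennreal (norm (\<psi> x)) * ennreal (norm (grad \<psi> x)) \<partial>lborel) \<le> ennreal (X * Y)"
      by (rule le_of_square_le_ennreal) (use XY in simp)
    have "(\<integral>\<^sup>+x. ennreal (norm (partial i w x)) \<partial>lborel)
        \<le> (\<integral>\<^sup>+x. 2 * (ennreal (norm (\<psi> x)) * ennreal (norm (grad \<psi> x))) \<partial>lborel)"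
    proof (rule nn_integral_mono)
      fix x
      show "ennreal (norm (partial i w x)) \<le> 2 * (ennreal (norm (\<psi> x)) * ennreal (norm (grad \<psi> x)))"
        using ennreal_leI[OF w_partial[of x]] by (simp add: ennreal_mult)
    qed
    also have "\<dots> = 2 * (\<integral>\<^sup>+x. ennreal (norm (\<psi> x)) * ennreal (norm (grad \<psi> x)) \<partial>lborel)"
      by (rule nn_integral_cmult) measurable
    also have "\<dots> \<le> 2 * ennreal (X * Y)"
      by (intro mult_left_mono CS) simp
    also have "\<dots> = ennreal (2 * (X * Y))"
      using XY by (simp add: ennreal_mult)
    finally show ?thesis
      using XY by (intro integral_real_bounded) auto
  qed
  show "norm (LINT x|lebesgue. f x * partial i (\<lambda>x. \<psi> x * cnj (\<psi> x)) x)
      \<le> (2 * sqrt (240 * weight_const * (1 + D * CARD('n))) + 4 * (D * M))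
        * (l2_norm \<psi> * l2_norm (grad \<psi>) + h * (l2_norm (grad \<psi>))\<^sup>2 + (l2_norm \<psi>)\<^sup>2 / h)" if h: "0 < h" for h
  proof -
    let ?A = "cell_mean h f"
    have "(\<integral>\<^sup>+x. ennreal (norm ((f x - ?A x) * partial i w x)) \<partial>lebesgue)
        \<le> (\<integral>\<^sup>+x. 2 * ennreal (norm (f x - ?A x) * norm (\<psi> x) * norm (grad \<psi> x)) \<partial>lebesgue)"
    proof (rule nn_integral_mono)
      fix x
      have "norm ((f x - ?A x) * partial i w x) \<le> 2 * (norm (f x - ?A x) * norm (\<psi> x) * norm (grad \<psi> x))"
        using mult_left_mono[OF w_partial[of x] norm_ge_zero[of "f x - ?A x"]] by (simp add: norm_mult mult_ac)
      then show "ennreal (norm ((f x - ?A x) * partial i w x))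
          \<le> 2 * ennreal (norm (f x - ?A x) * norm (\<psi> x) * norm (grad \<psi> x))"
        by (subst (asm) ennreal_le_iff[symmetric]) (auto simp: ennreal_mult'')
    qed
    also have "\<dots> = 2 * (\<integral>\<^sup>+x. ennreal (norm (f x - ?A x) * norm (\<psi> x) * norm (grad \<psi> x)) \<partial>lebesgue)"
      by (rule nn_integral_cmult) measurable
    also have "\<dots> \<le> 2 * ennreal (c * (X + h * Y) * Y)"
      unfolding c_def X_def Y_def by (intro mult_left_mono oscillation_part[OF \<psi> h]) simp
    also have "\<dots> = ennreal (2 * (c * (X + h * Y) * Y))"
      using XY c h by (simp add: ennreal_mult')
    finally have osc: "(\<integral>\<^sup>+x. ennreal (norm ((f x - ?A x) * partial i w x)) \<partial>lebesgue)
        \<le> ennreal (2 * (c * (X + h * Y) * Y))" .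
    have osc_integrable: "integrable lebesgue (\<lambda>x. (f x - ?A x) * partial i w x)"
      by (rule integrableI_bounded) (use osc in \<open>auto intro: le_less_trans\<close>)
    have "ennreal (norm (LINT x|lebesgue. (f x - ?A x) * partial i w x)) \<le> ennreal (2 * (c * (X + h * Y) * Y))"
      using integral_norm_bound_ennreal[OF osc_integrable] osc by (rule order_trans)
    then have 1: "norm (LINT x|lebesgue. (f x - ?A x) * partial i w x) \<le> 2 * (c * (X + h * Y) * Y)"
      using XY c h by (simp add: ennreal_le_iff)
    note A = cell_mean_derivative_pairing[OF w.C1_function_axioms h C0' C1']
    have "h * norm (LINT x|lborel. ?A x * partial i w x) \<le> 2 * (D * M) * (h * (2 * (X * Y)) + X\<^sup>2)"
      using A(2) mult_left_mono[OF int_p, of h] h DM unfolding int_w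
      by (elim order_trans) (intro mult_left_mono add_right_mono; simp)
    then have 2: "norm (LINT x|lborel. ?A x * partial i w x) \<le> 2 * (D * M) * (2 * (X * Y) + X\<^sup>2 / h)"
      using h by (simp add: field_simps)
    have "(LINT x|lebesgue. f x * partial i w x)
        = (LINT x|lebesgue. (f x - ?A x) * partial i w x + ?A x * partial i w x)"
      by (simp add: algebra_simps)
    also have "\<dots> = (LINT x|lebesgue. (f x - ?A x) * partial i w x) + (LINT x|lborel. ?A x * partial i w x)"
      using A(1) by (subst Bochner_Integration.integral_add[OF osc_integrable])
        (simp_all add: integrable_completion integral_completion)
    finally have "norm (LINT x|lebesgue. f x * partial i w x)
        \<le> 2 * (c * (X + h * Y) * Y) + 2 * (D * M) * (2 * (X * Y) + X\<^sup>2 / h)"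
      using 1 2 by (simp only:) (rule norm_triangle_le, simp)
    also have "\<dots> \<le> (2 * c + 4 * (D * M)) * (X * Y + h * Y\<^sup>2 + X\<^sup>2 / h)"
    proof -
      \<comment> \<open>Naming the quotient makes the remaining inequality linear in products of atoms.\<close>
      define z where "z = X\<^sup>2 / h"
      have "0 \<le> c * z" "0 \<le> D * M * (h * Y\<^sup>2)" "0 \<le> D * M * z"
        using c DM h by (simp_all add: z_def)
      then show ?thesis
        unfolding z_def[symmetric] by (simp add: algebra_simps power2_eq_square)
    qed
    finally show ?thesis by (simp add: w_def c_def X_def Y_def)
  qed
qed (use weight_const_nonneg D_nonneg M_pos in \<open>simp_all add: l2_norm_nonneg\<close>)

end

section \<open>Divergences of bounded mean oscillation matrices\<close>

lemma BMO_imp_bounded_mean_oscillation: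
  fixes f :: "real^'n::finite \<Rightarrow> complex"
  assumes "f \<in> BMO" "BMO_norm f \<le> M" "0 < M"
  shows "bounded_mean_oscillation f M (2 ^ CARD('n))"
proof
  show "mean_oscillation f (cube a l) \<le> M" if "0 < l" for a l
  proof -
    have "mean_oscillation f (cube a l) \<le> BMO_norm f"
      unfolding BMO_norm_def using assms(1) that by (intro cSup_upper) (auto simp: BMO_def)
    with assms(2) show ?thesis by simp
  qed
qed (use assms in \<open>auto simp: BMO_def\<close>)

theorem proposition1p1:
  fixes b :: "real \<Rightarrow> 'n::finite \<Rightarrow> 'n functional"
  assumes "CARD('n) \<ge> 3"
    and "b \<in> Linf_BMO_inv"
  shows "\<exists>\<delta>>0. b \<in> M_class \<delta>"
proof -
  obtain B :: "real \<Rightarrow> real^'n \<Rightarrow> complex^'n^'n" where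
    B: "\<And>i k. (\<lambda>t x. B t x $ i $ k) \<in> Linf_BMO"
    and b: "AE t in lebesgue_on {0..}. \<forall>k. \<forall>\<phi>\<in>schwartz.
      b t k \<phi> = (\<Sum>i\<in>UNIV. dist_partial i (dist_of (\<lambda>x. B t x $ i $ k)) \<phi>)"
    and tempered: "tempered_field b"
    using assms(2) unfolding Linf_BMO_inv_def by blast
  define m where "m i k = (SOME M. AE t in lebesgue_on {0..}.
      (\<lambda>x. B t x $ i $ k) \<in> BMO \<and> BMO_norm (\<lambda>x. B t x $ i $ k) \<le> M)" for i k
  have m: "AE t in lebesgue_on {0..}.
      (\<lambda>x. B t x $ i $ k) \<in> BMO \<and> BMO_norm (\<lambda>x. B t x $ i $ k) \<le> m i k" for i k
    unfolding m_def by (rule someI_ex) (use B[of i k] in \<open>simp add: Linf_BMO_def\<close>)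
  \<comment> \<open>One bound for all entries of \<open>B\<close>; the summand 1 makes it positive.\<close>
  define M where "M = 1 + (\<Sum>i\<in>UNIV. \<Sum>k\<in>UNIV. \<bar>m i k\<bar>)"
  define D :: real where "D = 2 ^ CARD('n)"
  define K where "K = 3 * (2 * sqrt (240 * bounded_mean_oscillation.weight_const M D * (1 + D * CARD('n))) + 4 * (D * M))"
  have M: "0 < M" "m i k \<le> M" for i k
  proof -
    show "0 < M" unfolding M_def by (intro add_pos_nonneg sum_nonneg) auto
    have "\<bar>m i k\<bar> \<le> (\<Sum>k\<in>UNIV. \<bar>m i k\<bar>)" by (rule member_le_sum) auto
    also have "\<dots> \<le> (\<Sum>i\<in>UNIV. \<Sum>k\<in>UNIV. \<bar>m i k\<bar>)"
      by (rule member_le_sum[where f = "\<lambda>i. \<Sum>k\<in>UNIV. \<bar>m i k\<bar>"]) (auto intro: sum_nonneg)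
    finally show "m i k \<le> M" by (simp add: M_def)
  qed
  have BMO: "AE t in lebesgue_on {0..}. \<forall>i\<in>UNIV. \<forall>k\<in>UNIV. bounded_mean_oscillation (\<lambda>x. B t x $ i $ k) M D"
  proof (intro AE_finite_allI finite)
    show "AE t in lebesgue_on {0..}. bounded_mean_oscillation (\<lambda>x. B t x $ i $ k) M D" for i k
      using m[of i k]
    proof eventually_elim
      fix t assume "(\<lambda>x. B t x $ i $ k) \<in> BMO \<and> BMO_norm (\<lambda>x. B t x $ i $ k) \<le> m i k"
      then show "bounded_mean_oscillation (\<lambda>x. B t x $ i $ k) M D"
        unfolding D_def using M by (intro BMO_imp_bounded_mean_oscillation) (auto intro: order_trans)
    qed
  qed
  \<comment> \<open>Each of the \<open>d\<close> components is a sum of \<open>d\<close> terms; the summand 1 makes \<open>\<delta>\<close> positive.\<close>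
  define \<delta> where "\<delta> = CARD('n) * (CARD('n) * \<bar>K\<bar>) + 1"
  have "AE t in lebesgue_on {0..}. \<forall>\<psi>\<in>schwartz.
      norm (\<chi> k. dist_pairing (dist_mult (b t k) \<psi>) \<psi>)
        \<le> \<delta> * l2_norm (grad \<psi>) * l2_norm \<psi> + 0 * (l2_norm \<psi>)\<^sup>2"
    using b BMO
  proof eventually_elim
    fix t
    assume bt: "\<forall>k. \<forall>\<phi>\<in>schwartz. b t k \<phi> = (\<Sum>i\<in>UNIV. dist_partial i (dist_of (\<lambda>x. B t x $ i $ k)) \<phi>)"
      and bmo: "\<forall>i\<in>UNIV. \<forall>k\<in>UNIV. bounded_mean_oscillation (\<lambda>x. B t x $ i $ k) M D"
    show "\<forall>\<psi>\<in>schwartz. norm (\<chi> k. dist_pairing (dist_mult (b t k) \<psi>) \<psi>)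
        \<le> \<delta> * l2_norm (grad \<psi>) * l2_norm \<psi> + 0 * (l2_norm \<psi>)\<^sup>2"
    proof
      fix \<psi> :: "real^'n \<Rightarrow> complex" assume \<psi>: "\<psi> \<in> schwartz"
      let ?w = "\<lambda>x. \<psi> x * cnj (\<psi> x)"
      let ?N = "l2_norm \<psi> * l2_norm (grad \<psi>)"
      have N: "0 \<le> ?N" by (simp add: l2_norm_nonneg)
      have entry: "norm (dist_partial i (dist_of (\<lambda>x. B t x $ i $ k)) ?w) \<le> \<bar>K\<bar> * ?N" for i k
      proof -
        have "norm (dist_partial i (dist_of (\<lambda>x. B t x $ i $ k)) ?w) \<le> K * ?N"
          using bounded_mean_oscillation.derivative_pairing_le[OF _ \<psi>] bmo
          by (simp add: dist_partial_def dist_of_def K_def mult.assoc)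
        also have "\<dots> \<le> \<bar>K\<bar> * ?N" using N by (intro mult_right_mono) auto
        finally show ?thesis .
      qed
      have "norm (dist_pairing (dist_mult (b t k) \<psi>) \<psi>) \<le> CARD('n) * (\<bar>K\<bar> * ?N)" for k
      proof -
        have "dist_pairing (dist_mult (b t k) \<psi>) \<psi>
            = (\<Sum>i\<in>UNIV. dist_partial i (dist_of (\<lambda>x. B t x $ i $ k)) ?w)"
          using bt schwartz_mult[OF \<psi> schwartz_cnj[OF \<psi>]] by (simp add: dist_pairing_def dist_mult_def)
        also have "norm \<dots> \<le> (\<Sum>i\<in>(UNIV :: 'n set). \<bar>K\<bar> * ?N)"
          by (intro sum_norm_le entry)
        finally show ?thesis by simp
      qed
      then have "norm (\<chi> k. dist_pairing (dist_mult (b t k) \<psi>) \<psi>) \<le> (\<Sum>k\<in>(UNIV :: 'n set). CARD('n) * (\<bar>K\<bar> * ?N))"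
        unfolding norm_vec_def by (intro order_trans[OF L2_set_le_sum] sum_mono) simp_all
      also have "\<dots> = CARD('n) * (CARD('n) * \<bar>K\<bar>) * ?N" by simp
      also have "\<dots> \<le> \<delta> * ?N" using N by (intro mult_right_mono) (simp_all add: \<delta>_def)
      finally show "norm (\<chi> k. dist_pairing (dist_mult (b t k) \<psi>) \<psi>)
          \<le> \<delta> * l2_norm (grad \<psi>) * l2_norm \<psi> + 0 * (l2_norm \<psi>)\<^sup>2"
        by (simp add: mult_ac)
    qed
  qed
  then have "b \<in> M_class \<delta>"
    unfolding M_class_def using tempered
    by (auto intro!: exI[of _ "\<lambda>_. 0"] exI[of _ "0::real"] simp: set_lebesgue_integral_def set_integrable_def)
  moreover have "0 < \<delta>" by (simp add: \<delta>_def add_nonneg_pos)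
  ultimately show ?thesis by blast
qed

end
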